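(* There is a unique formal series solution of $q$-$P(A_1)$ of the form $$f^{0,+}=\sum_{n\ge1}\sum_{i\le n}F^{0,+}_{n,i}(\Lambda,\mathbf b)\phi^it^n,\qquad g^{0,+}=\sum_{n\ge1}\sum_{i\le n}G^{0,+}_{n,i}(\Lambda,\mathbf b)\phi^it^n$$ with $F^{0,+}_{1,1}=1$ and $G^{0,+}_{1,1}=\Lambda$. Each coefficient $F^{0,+}_{n,i},G^{0,+}_{n,i}$ ($n\ge1$, $i\le n$) is a rational function of $(\Lambda,\mathbf b)$, regular at every $(\Lambda,\mathbf b)\in\mathbb C^*\times\mathcal B$ such that $1\notin Q:=\{q_1^mq_2^n:(m,n)\in\mathbb N^2\setminus\{(0,0)\}\}$, where $q_1=q\lambda$, $q_2=\lambda^{-1}$. Moreover, fix $\mathbf b\in\mathcal B$ with $|q|<1$ and let $L_0(\mathbf b)=\{x\in\mathbb C^*:|b_1b_2b_3b_4|<|x|^2<|b_5b_6b_7b_8|\}$. For every $\Lambda\in L_0(\mathbf b)$ the condition $1\notin Q$ holds, and the double series $$\sum_{n\ge1}\sum_{m\ge0}F^{0,+}_{n,n-m}(\Lambda,\mathbf b)\zeta_1^n\zeta_2^m,\qquad \sum_{n\ge1}\sum_{m\ge0}G^{0,+}_{n,n-m}(\Lambda,\mathbf b)\zeta_1^n\zeta_2^m$$ (obtained by writing $\zeta_1=t\phi$, $\zeta_2=\phi^{-1}$) converge in a neighbourhood of $(\zeta_1,\zeta_2)=(0,0)$. More precisely, for every open $L$ with $\overline L\subseteq L_0(\mathbf b)$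 there is an open neighbourhood $Z\subseteq\mathbb C^2$ of $\mathbf 0$ such that these series converge uniformly on $Z\times L$ and define holomorphic functions of $(\zeta_1,\zeta_2,\Lambda)$ there.
   Context: Parameters: $\mathcal B=\{\mathbf b=(b_1,\dots,b_8)\in\mathbb C^8: b_i\neq0\}$, $q=\frac{b_1b_2b_3b_4}{b_5b_6b_7b_8}$. The equation $q$-$P(A_1)$ for unknowns $f=f(t)$, $g=g(t)$ is $$(gf-t^2)(g\bar f-qt^2)(g-b_5)(g-b_6)(g-b_7)(g-b_8)=(gf-1)(g\bar f-1)(g-b_1t)(g-b_2t)(g-b_3t)(g-b_4t),$$ $$(g\bar f-qt^2)(\bar g\bar f-q^2t^2)(\bar f-b_5^{-1})(\bar f-b_6^{-1})(\bar f-b_7^{-1})(\bar f-b_8^{-1})=(g\bar f-1)(\bar g\bar f-1)(\bar f-b_1^{-1}qt)(\bar f-b_2^{-1}qt)(\bar f-b_3^{-1}qt)(\bar f-b_4^{-1}qt),$$ where $\bar\cdot$ denotes the shift $t\mapsto qt$. Formal setting: $\Lambda,\phi$ are indeterminates, $\lambda=\Lambda^2/(b_1b_2b_3b_4)$. Consider pairs $f=\sum_{n\ge1}F_n(\phi)t^n$, $g=\sum_{n\ge1}G_n(\phi)t^n$ where $F_n(\phi)=\sum_{i\le n}F_{n,i}\phi^i$, $G_n(\phi)=\sum_{i\le n}G_{n,i}\phi^i$ are Laurent series in $\phi$ with finitely many positive powers and coefficients depending on $(\Lambda,\mathbf b)$. The shift acts by $t\mapsto qt$, $\phi\mapsto\lambda\phi$,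 $\Lambda\mapsto\Lambda$, i.e. $\bar f=\sum_{n\ge1}q^nF_n(\lambda\phi)t^n$, $\bar g=\sum_{n\ge1}q^nG_n(\lambda\phi)t^n$. Such a pair is a formal series solution of $q$-$P(A_1)$ if both equations above hold identically as formal series in $t$ whose coefficients are Laurent series in $\phi$. *)

theory Defs
  imports "HOL-Analysis.Analysis"
begin

text \<open>An element  sum_{n>=0} sum_{i<=n} A n i * phi^i * t^n  is represented by its
  coefficient function A :: nat => int => complex, A n i = coefficient of t^n phi^i.
  All series occurring in q-P(A1) (f, g, their shifts, constants, b_j t, t^2) satisfy
  A n i = 0 for i > n; on such series the following product is the genuine product
  of formal series (every coefficient is a finite sum).\<close>

type_synonym tps = "nat \<Rightarrow> int \<Rightarrow> complex"

definition tp_mult :: "tps \<Rightarrow> tps \<Rightarrow> tps" where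
  "tp_mult A B n k = (\<Sum>a\<in>{0..n}. \<Sum>i\<in>{k - int (n - a)..int a}. A a i * B (n - a) (k - i))"

definition tp_add :: "tps \<Rightarrow> tps \<Rightarrow> tps" where
  "tp_add A B n k = A n k + B n k"

definition tp_diff :: "tps \<Rightarrow> tps \<Rightarrow> tps" where
  "tp_diff A B n k = A n k - B n k"

definition tp_mon :: "nat \<Rightarrow> complex \<Rightarrow> tps" where
  "tp_mon j c n k = (if n = j \<and> k = 0 then c else 0)"

definition tp_prod :: "tps list \<Rightarrow> tps" where
  "tp_prod xs = foldr tp_mult xs (tp_mon 0 1)"

text \<open>The shift  t -> q t, phi -> lam phi.\<close>
definition tp_shift :: "complex \<Rightarrow> complex \<Rightarrow> tps \<Rightarrow> tps" where
  "tp_shift q lam A n k = q ^ n * lam powi k * A n k"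

definition qPA1_q :: "(nat \<Rightarrow> complex) \<Rightarrow> complex" where
  "qPA1_q b = (b 1 * b 2 * b 3 * b 4) / (b 5 * b 6 * b 7 * b 8)"

definition qPA1_lambda :: "complex \<Rightarrow> (nat \<Rightarrow> complex) \<Rightarrow> complex" where
  "qPA1_lambda Lam b = Lam ^ 2 / (b 1 * b 2 * b 3 * b 4)"

definition qPA1_eq1 :: "complex \<Rightarrow> (nat \<Rightarrow> complex) \<Rightarrow> tps \<Rightarrow> tps \<Rightarrow> bool" where
  "qPA1_eq1 Lam b f g \<longleftrightarrow>
     (let q = qPA1_q b; lam = qPA1_lambda Lam b; fb = tp_shift q lam f in
      tp_prod [tp_diff (tp_mult g f) (tp_mon 2 1),
               tp_diff (tp_mult g fb) (tp_mon 2 q),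
               tp_diff g (tp_mon 0 (b 5)), tp_diff g (tp_mon 0 (b 6)),
               tp_diff g (tp_mon 0 (b 7)), tp_diff g (tp_mon 0 (b 8))]
    = tp_prod [tp_diff (tp_mult g f) (tp_mon 0 1),
               tp_diff (tp_mult g fb) (tp_mon 0 1),
               tp_diff g (tp_mon 1 (b 1)), tp_diff g (tp_mon 1 (b 2)),
               tp_diff g (tp_mon 1 (b 3)), tp_diff g (tp_mon 1 (b 4))])"

definition qPA1_eq2 :: "complex \<Rightarrow> (nat \<Rightarrow> complex) \<Rightarrow> tps \<Rightarrow> tps \<Rightarrow> bool" where
  "qPA1_eq2 Lam b f g \<longleftrightarrow>
     (let q = qPA1_q b; lam = qPA1_lambda Lam b;
          fb = tp_shift q lam f; gb = tp_shift q lam g in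
      tp_prod [tp_diff (tp_mult g fb) (tp_mon 2 q),
               tp_diff (tp_mult gb fb) (tp_mon 2 (q ^ 2)),
               tp_diff fb (tp_mon 0 (inverse (b 5))), tp_diff fb (tp_mon 0 (inverse (b 6))),
               tp_diff fb (tp_mon 0 (inverse (b 7))), tp_diff fb (tp_mon 0 (inverse (b 8)))]
    = tp_prod [tp_diff (tp_mult g fb) (tp_mon 0 1),
               tp_diff (tp_mult gb fb) (tp_mon 0 1),
               tp_diff fb (tp_mon 1 (inverse (b 1) * q)), tp_diff fb (tp_mon 1 (inverse (b 2) * q)),
               tp_diff fb (tp_mon 1 (inverse (b 3) * q)), tp_diff fb (tp_mon 1 (inverse (b 4) * q))])"

definition qPA1_formal_sol :: "complex \<Rightarrow> (nat \<Rightarrow> complex) \<Rightarrow> tps \<Rightarrow> tps \<Rightarrow> bool" where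
  "qPA1_formal_sol Lam b f g \<longleftrightarrow>
     (\<forall>n i. (n = 0 \<or> int n < i) \<longrightarrow> f n i = 0 \<and> g n i = 0)
     \<and> qPA1_eq1 Lam b f g \<and> qPA1_eq2 Lam b f g"

definition qPA1_B :: "(nat \<Rightarrow> complex) set" where
  "qPA1_B = {b. \<forall>j\<in>{1..8}. b j \<noteq> 0}"

definition qPA1_Q :: "complex \<Rightarrow> (nat \<Rightarrow> complex) \<Rightarrow> complex set" where
  "qPA1_Q Lam b = {(qPA1_q b * qPA1_lambda Lam b) ^ m * (inverse (qPA1_lambda Lam b)) ^ n
                    | m n :: nat. (m, n) \<noteq> (0, 0)}"

definition qPA1_good :: "(complex \<times> (nat \<Rightarrow> complex)) set" where
  "qPA1_good = {(Lam, b). Lam \<noteq> 0 \<and> b \<in> qPA1_B \<and> 1 \<notin> qPA1_Q Lam b}"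

definition qPA1_L0 :: "(nat \<Rightarrow> complex) \<Rightarrow> complex set" where
  "qPA1_L0 b = {x. x \<noteq> 0 \<and> norm (b 1 * b 2 * b 3 * b 4) < norm x ^ 2
                     \<and> norm x ^ 2 < norm (b 5 * b 6 * b 7 * b 8)}"

definition poly_fun9 :: "(complex \<Rightarrow> (nat \<Rightarrow> complex) \<Rightarrow> complex) \<Rightarrow> bool" where
  "poly_fun9 P \<longleftrightarrow> (\<exists>(S :: (nat \<times> (nat \<Rightarrow> nat)) set) c. finite S \<and>
     (\<forall>Lam b. P Lam b = (\<Sum>(e0, e)\<in>S. c (e0, e) * Lam ^ e0 * (\<Prod>j\<in>{1..8}. b j ^ e j))))"

definition rat_fun_regular_on ::
  "(complex \<times> (nat \<Rightarrow> complex)) set \<Rightarrow> (complex \<Rightarrow> (nat \<Rightarrow> complex) \<Rightarrow> complex) \<Rightarrow> bool" where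
  "rat_fun_regular_on U h \<longleftrightarrow> (\<exists>N D. poly_fun9 N \<and> poly_fun9 D \<and>
     (\<forall>(Lam, b)\<in>U. D Lam b \<noteq> 0 \<and> h Lam b = N Lam b / D Lam b))"

definition holo3_on :: "((complex \<times> complex) \<times> complex \<Rightarrow> complex) \<Rightarrow> ((complex \<times> complex) \<times> complex) set \<Rightarrow> bool" where
  "holo3_on h S \<longleftrightarrow> (\<forall>p\<in>S. \<exists>a1 a2 a3.
     (h has_derivative (\<lambda>((z1, z2), z3). a1 * z1 + a2 * z2 + a3 * z3)) (at p))"

end

theory Submission
  imports Defs "HOL-Complex_Analysis.Complex_Analysis"
begin

text \<open>In the variables \<open>z1 = t * phi\<close>, \<open>z2 = 1 / phi\<close> the shift multiplies \<open>z1 ^ n * z2 ^ m\<close> by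
  \<open>s = q1 ^ n * q2 ^ m\<close>. Write \<open>f = z1 * (1 + x)\<close> and \<open>g = Lam * z1 * (1 + y)\<close> with \<open>x\<close>, \<open>y\<close> power series
  without constant term. Both equations become divisible by \<open>z1 ^ 4\<close>, and their linear part acts on
  each coefficient by a matrix of determinant \<open>(1 - s) ^ 2\<close>. If \<open>1\<close> is not in \<open>Q\<close> it can be inverted, and
  the equations turn into a fixed point problem whose right-hand side consists of terms that are at
  least quadratic in \<open>(x, y)\<close> or contain a factor \<open>z1\<close> or \<open>z2\<close>. Picard iteration then determines the
  coefficients degree by degree, and they are rational. On compact subsets of \<open>L_0\<close> both \<open>q1\<close> and \<open>q2\<close>
  stay in a disc of radius less than 1, so the inverse matrices are bounded, and the iteration preserves a
  small ball in a weighted l1-norm; this gives geometric bounds on the coefficients.\<close>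

subsection \<open>Rational functions of the parameters\<close>

text \<open>The definition of \<open>lambda\<close> is what makes a solution of this shape possible:
  in both equations the coefficients of \<open>z1 ^ 4\<close> balance because
  \<open>q1 * (b 5 * b 6 * b 7 * b 8) = Lam ^ 2\<close>. The linear part degenerates exactly where
  \<open>s = 1\<close>. At \<open>n = m = 0\<close> this always happens and reflects the freedom to
  rescale \<open>phi\<close>; prescribing the two leading coefficients removes it.

  The obstacle is that either side of each equation is a product of six factors, while several facts
  are needed about its nonlinear part: it raises the order of differences, preserves rationality and
  obeys bounds uniform in the truncation. Expanding the products is avoided. An inductively defined
  class of operators is closed under sums, products and diagonal multipliers, and each of these
  facts is one induction over that class. Linear parts add when operators of the form one plus small
  are multiplied, so the linear part of an equation is read off factor by factor. The same iterates
  serve every parameter in \<open>qPA1_good\<close>, so the rationality and the bounds concern the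
  same coefficients.\<close>

lemma poly_fun9_finite_sum:
  assumes "finite I"
    and P: "\<And>Lam b. P Lam b = (\<Sum>i\<in>I. a i * Lam ^ dg i * (\<Prod>j\<in>{1..8}. b j ^ e i j))"
  shows "poly_fun9 P"
proof -
  define g where "g i = (dg i, e i)" for i
  \<comment> \<open>Several indices may share an exponent vector, whereas \<open>poly_fun9\<close>
    wants one coefficient per exponent vector; hence the sum over the fibre of
    \<open>g\<close>.\<close>
  define c where "c y = (\<Sum>i\<in>{i\<in>I. g i = y}. a i)" for y
  have "P Lam b = (\<Sum>(d0, d)\<in>g ` I. c (d0, d) * Lam ^ d0 * (\<Prod>j\<in>{1..8}. b j ^ d j))" for Lam b
  proof -
    have "P Lam b = (\<Sum>y\<in>g ` I. \<Sum>i\<in>{i\<in>I. g i = y}. a i * Lam ^ dg i * (\<Prod>j\<in>{1..8}. b j ^ e i j))"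
      unfolding P by (rule sum.image_gen[OF \<open>finite I\<close>])
    also have "\<dots> = (\<Sum>(d0, d)\<in>g ` I. c (d0, d) * Lam ^ d0 * (\<Prod>j\<in>{1..8}. b j ^ d j))"
      unfolding c_def sum_distrib_right by (intro sum.cong refl) (auto simp: g_def intro!: sum.cong)
    finally show ?thesis .
  qed
  then show ?thesis
    unfolding poly_fun9_def using \<open>finite I\<close> by (intro exI[of _ "g ` I"] exI[of _ c]) auto
qed

lemma poly_fun9_const: "poly_fun9 (\<lambda>Lam b. c)"
  by (rule poly_fun9_finite_sum[where I = "{()}" and a = "\<lambda>_. c" and dg = "\<lambda>_. 0" and e = "\<lambda>_ _. 0"]) auto

lemma poly_fun9_Lam: "poly_fun9 (\<lambda>Lam b. Lam)"
  by (rule poly_fun9_finite_sum[where I = "{()}" and a = "\<lambda>_. 1" and dg = "\<lambda>_. 1" and e = "\<lambda>_ _. 0"]) auto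

lemma poly_fun9_b:
  assumes "k \<in> {1..8}"
  shows "poly_fun9 (\<lambda>Lam b. b k)"
proof (rule poly_fun9_finite_sum[where I = "{()}" and a = "\<lambda>_. 1" and dg = "\<lambda>_. 0"
      and e = "\<lambda>_ j. if j = k then 1 else 0"])
  fix Lam :: complex and b :: "nat \<Rightarrow> complex"
  have "(\<Prod>j\<in>{1..8}. b j ^ (if j = k then 1 else 0)) = (\<Prod>j\<in>{1..8}. if j = k then b j else 1)"
    by (intro prod.cong) auto
  then show "b k = (\<Sum>i\<in>{()}. 1 * Lam ^ 0 * (\<Prod>j\<in>{1..8}. b j ^ (if j = k then 1 else 0)))"
    using assms by simp
qed auto

lemma poly_fun9_add:
  assumes "poly_fun9 P" "poly_fun9 R"
  shows "poly_fun9 (\<lambda>Lam b. P Lam b + R Lam b)"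
proof -
  obtain S c where S: "finite S"
    "\<And>Lam b. P Lam b = (\<Sum>(e0, e)\<in>S. c (e0, e) * Lam ^ e0 * (\<Prod>j\<in>{1..8}. b j ^ e j))"
    using assms(1) unfolding poly_fun9_def by auto
  obtain S' c' where S': "finite S'"
    "\<And>Lam b. R Lam b = (\<Sum>(e0, e)\<in>S'. c' (e0, e) * Lam ^ e0 * (\<Prod>j\<in>{1..8}. b j ^ e j))"
    using assms(2) unfolding poly_fun9_def by auto
  show ?thesis
    by (rule poly_fun9_finite_sum[where I = "S <+> S'" and a = "case_sum c c'"
          and dg = "case_sum fst fst" and e = "case_sum snd snd"])
       (use S S' in \<open>auto simp: sum.Plus split_beta\<close>)
qed

lemma poly_fun9_mult:
  assumes "poly_fun9 P" "poly_fun9 R"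
  shows "poly_fun9 (\<lambda>Lam b. P Lam b * R Lam b)"
proof -
  obtain S c where S: "finite S"
    "\<And>Lam b. P Lam b = (\<Sum>(e0, e)\<in>S. c (e0, e) * Lam ^ e0 * (\<Prod>j\<in>{1..8}. b j ^ e j))"
    using assms(1) unfolding poly_fun9_def by auto
  obtain S' c' where S': "finite S'"
    "\<And>Lam b. R Lam b = (\<Sum>(e0, e)\<in>S'. c' (e0, e) * Lam ^ e0 * (\<Prod>j\<in>{1..8}. b j ^ e j))"
    using assms(2) unfolding poly_fun9_def by auto
  show ?thesis
  proof (rule poly_fun9_finite_sum[where I = "S \<times> S'" and a = "\<lambda>(s, s'). c s * c' s'"
          and dg = "\<lambda>(s, s'). fst s + fst s'" and e = "\<lambda>(s, s') j. snd s j + snd s' j"])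
    show "P Lam b * R Lam b = (\<Sum>i\<in>S \<times> S'. (case i of (s, s') \<Rightarrow> c s * c' s') *
            Lam ^ (case i of (s, s') \<Rightarrow> fst s + fst s') *
            (\<Prod>j\<in>{1..8}. b j ^ (case i of (s, s') \<Rightarrow> \<lambda>j. snd s j + snd s' j) j))" for Lam b
      unfolding S S' sum_product sum.cartesian_product
      by (intro sum.cong refl) (auto simp: power_add prod.distrib)
  qed (use S S' in auto)
qed

lemma poly_fun9_holomorphic: "poly_fun9 P \<Longrightarrow> (\<lambda>Lam. P Lam b) holomorphic_on V"
  unfolding poly_fun9_def by (auto simp: split_beta intro!: holomorphic_intros)

abbreviation (input) rational :: "(complex \<Rightarrow> (nat \<Rightarrow> complex) \<Rightarrow> complex) \<Rightarrow> bool" where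
  "rational \<equiv> rat_fun_regular_on qPA1_good"

lemma rationalE:
  assumes "rational h"
  obtains N D where "poly_fun9 N" "poly_fun9 D"
    "\<And>Lam b. (Lam, b) \<in> qPA1_good \<Longrightarrow> D Lam b \<noteq> 0 \<and> h Lam b = N Lam b / D Lam b"
  using assms unfolding rat_fun_regular_on_def by blast

lemma rationalI:
  assumes "poly_fun9 N" "poly_fun9 D"
    "\<And>Lam b. (Lam, b) \<in> qPA1_good \<Longrightarrow> D Lam b \<noteq> 0 \<and> h Lam b = N Lam b / D Lam b"
  shows "rational h"
  using assms unfolding rat_fun_regular_on_def by blast

lemma rational_poly: "poly_fun9 P \<Longrightarrow> rational P"
  by (rule rationalI[OF _ poly_fun9_const[of 1]]) auto

lemmas rational_const = rational_poly[OF poly_fun9_const]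
lemmas rational_Lam = rational_poly[OF poly_fun9_Lam]
lemmas rational_b = rational_poly[OF poly_fun9_b]

lemma rational_add:
  assumes "rational h" "rational k"
  shows "rational (\<lambda>Lam b. h Lam b + k Lam b)"
proof -
  obtain N D where h: "poly_fun9 N" "poly_fun9 D"
    "\<And>Lam b. (Lam, b) \<in> qPA1_good \<Longrightarrow> D Lam b \<noteq> 0 \<and> h Lam b = N Lam b / D Lam b"
    using rationalE[OF assms(1)] by blast
  obtain N' D' where k: "poly_fun9 N'" "poly_fun9 D'"
    "\<And>Lam b. (Lam, b) \<in> qPA1_good \<Longrightarrow> D' Lam b \<noteq> 0 \<and> k Lam b = N' Lam b / D' Lam b"
    using rationalE[OF assms(2)] by blast
  show ?thesis
    by (rule rationalI[OF poly_fun9_add[OF poly_fun9_mult[OF h(1) k(2)] poly_fun9_mult[OF k(1) h(2)]]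
          poly_fun9_mult[OF h(2) k(2)]]) (use h(3) k(3) in \<open>simp add: add_frac_eq\<close>)
qed

lemma rational_mult:
  assumes "rational h" "rational k"
  shows "rational (\<lambda>Lam b. h Lam b * k Lam b)"
proof -
  obtain N D where h: "poly_fun9 N" "poly_fun9 D"
    "\<And>Lam b. (Lam, b) \<in> qPA1_good \<Longrightarrow> D Lam b \<noteq> 0 \<and> h Lam b = N Lam b / D Lam b"
    using rationalE[OF assms(1)] by blast
  obtain N' D' where k: "poly_fun9 N'" "poly_fun9 D'"
    "\<And>Lam b. (Lam, b) \<in> qPA1_good \<Longrightarrow> D' Lam b \<noteq> 0 \<and> k Lam b = N' Lam b / D' Lam b"
    using rationalE[OF assms(2)] by blast
  show ?thesis
    by (rule rationalI[OF poly_fun9_mult[OF h(1) k(1)] poly_fun9_mult[OF h(2) k(2)]])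
       (use h(3) k(3) in simp)
qed

lemma rational_inverse:
  assumes "rational h" and nz: "\<And>Lam b. (Lam, b) \<in> qPA1_good \<Longrightarrow> h Lam b \<noteq> 0"
  shows "rational (\<lambda>Lam b. inverse (h Lam b))"
proof -
  obtain N D where h: "poly_fun9 N" "poly_fun9 D"
    "\<And>Lam b. (Lam, b) \<in> qPA1_good \<Longrightarrow> D Lam b \<noteq> 0 \<and> h Lam b = N Lam b / D Lam b"
    using rationalE[OF assms(1)] by blast
  show ?thesis
    by (rule rationalI[OF h(2) h(1)]) (use h(3) nz in \<open>fastforce simp: field_simps\<close>)
qed

lemma rational_uminus: "rational h \<Longrightarrow> rational (\<lambda>Lam b. - h Lam b)"
  using rational_mult[OF rational_const[of "-1"]] by simp

lemma rational_diff: "rational h \<Longrightarrow> rational k \<Longrightarrow> rational (\<lambda>Lam b. h Lam b - k Lam b)"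
  using rational_add[OF _ rational_uminus] by fastforce

lemma rational_divide:
  "rational h \<Longrightarrow> rational k \<Longrightarrow> (\<And>Lam b. (Lam, b) \<in> qPA1_good \<Longrightarrow> k Lam b \<noteq> 0) \<Longrightarrow>
   rational (\<lambda>Lam b. h Lam b / k Lam b)"
  unfolding divide_inverse by (intro rational_mult rational_inverse)

lemma rational_power: "rational h \<Longrightarrow> rational (\<lambda>Lam b. h Lam b ^ n)"
  by (induction n) (auto intro: rational_const rational_mult)

lemma rational_sum: "(\<And>i. i \<in> I \<Longrightarrow> rational (h i)) \<Longrightarrow> rational (\<lambda>Lam b. \<Sum>i\<in>I. h i Lam b)"
  by (induction I rule: infinite_finite_induct) (auto intro: rational_const rational_add)

lemma rational_cong:
  "rational h \<Longrightarrow> (\<And>Lam b. (Lam, b) \<in> qPA1_good \<Longrightarrow> k Lam b = h Lam b) \<Longrightarrow> rational k"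
  unfolding rat_fun_regular_on_def by (fastforce simp: split_beta)

lemma rational_holomorphic:
  assumes "rational h" "\<And>Lam. Lam \<in> V \<Longrightarrow> (Lam, b) \<in> qPA1_good"
  shows "(\<lambda>Lam. h Lam b) holomorphic_on V"
proof -
  obtain N D where h: "poly_fun9 N" "poly_fun9 D"
    "\<And>Lam b. (Lam, b) \<in> qPA1_good \<Longrightarrow> D Lam b \<noteq> 0 \<and> h Lam b = N Lam b / D Lam b"
    using rationalE[OF assms(1)] by blast
  have "(\<lambda>Lam. N Lam b / D Lam b) holomorphic_on V"
    using h assms(2) by (intro holomorphic_on_divide poly_fun9_holomorphic) auto
  then show ?thesis
    by (rule holomorphic_transform) (use h assms(2) in auto)
qed

lemma rational_bounded:
  assumes "rational h" "compact V" "\<And>Lam. Lam \<in> V \<Longrightarrow> (Lam, b) \<in> qPA1_good"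
  shows "\<exists>C. \<forall>Lam\<in>V. norm (h Lam b) \<le> C"
proof -
  have "continuous_on V (\<lambda>Lam. h Lam b)"
    using rational_holomorphic[OF assms(1,3)] by (rule holomorphic_on_imp_continuous_on)
  then have "bounded ((\<lambda>Lam. h Lam b) ` V)"
    by (intro compact_imp_bounded compact_continuous_image \<open>compact V\<close>)
  then show ?thesis by (auto simp: bounded_iff)
qed

subsection \<open>The multipliers of the shift\<close>

definition q1 :: "complex \<Rightarrow> (nat \<Rightarrow> complex) \<Rightarrow> complex" where
  "q1 Lam b = qPA1_q b * qPA1_lambda Lam b"

definition q2 :: "complex \<Rightarrow> (nat \<Rightarrow> complex) \<Rightarrow> complex" where
  "q2 Lam b = inverse (qPA1_lambda Lam b)"

lemma qPA1_B_nz: "b \<in> qPA1_B \<Longrightarrow> b 1 \<noteq> 0 \<and> b 2 \<noteq> 0 \<and> b 3 \<noteq> 0 \<and> b 4 \<noteq> 0 \<and> b 5 \<noteq> 0 \<and> b 6 \<noteq> 0 \<and> b 7 \<noteq> 0 \<and> b 8 \<noteq> 0"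
  unfolding qPA1_B_def by auto

lemma qPA1_goodD: "(Lam, b) \<in> qPA1_good \<Longrightarrow> Lam \<noteq> 0 \<and> b \<in> qPA1_B"
  unfolding qPA1_good_def by auto

lemma q1_eq: "b \<in> qPA1_B \<Longrightarrow> q1 Lam b = Lam ^ 2 / (b 5 * b 6 * b 7 * b 8)"
  using qPA1_B_nz[of b] by (simp add: q1_def qPA1_q_def qPA1_lambda_def)

lemma q2_eq: "q2 Lam b = (b 1 * b 2 * b 3 * b 4) / Lam ^ 2"
  by (simp add: q2_def qPA1_lambda_def)

lemma q1_nz: "(Lam, b) \<in> qPA1_good \<Longrightarrow> q1 Lam b \<noteq> 0"
  using qPA1_goodD[of Lam b] qPA1_B_nz[of b] by (simp add: q1_eq)

lemma rational_q1: "rational q1"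
proof (rule rational_cong[where h = "\<lambda>Lam b. Lam ^ 2 / (b 5 * b 6 * b 7 * b 8)"])
  show "rational (\<lambda>Lam b. Lam ^ 2 / (b 5 * b 6 * b 7 * b 8))"
    by (intro rational_divide rational_mult rational_power rational_Lam rational_b)
       (auto dest!: qPA1_goodD qPA1_B_nz)
qed (use qPA1_goodD q1_eq in blast)

lemma rational_q2: "rational q2"
  unfolding q2_eq[abs_def]
  by (intro rational_divide rational_mult rational_power rational_Lam rational_b)
     (use qPA1_goodD in auto)

definition shift_factor :: "nat \<Rightarrow> nat \<Rightarrow> complex \<Rightarrow> (nat \<Rightarrow> complex) \<Rightarrow> complex" where
  "shift_factor n m Lam b = q1 Lam b ^ n * q2 Lam b ^ m"

lemma rational_shift_factor: "rational (shift_factor n m)"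
  unfolding shift_factor_def[abs_def] by (intro rational_mult rational_power rational_q1 rational_q2)

lemma shift_factor_neq_1:
  "(Lam, b) \<in> qPA1_good \<Longrightarrow> (n, m) \<noteq> (0, 0) \<Longrightarrow> shift_factor n m Lam b \<noteq> 1"
  unfolding qPA1_good_def qPA1_Q_def shift_factor_def q1_def q2_def by auto

text \<open>The two inequalities in \<open>qPA1_L0\<close> say exactly this once \<open>q1\<close>
  and \<open>q2\<close> are written as \<open>Lam ^ 2\<close> over
  \<open>b 5 * b 6 * b 7 * b 8\<close> and \<open>b 1 * b 2 * b 3 * b 4\<close> over
  \<open>Lam ^ 2\<close>.\<close>

lemma L0_norm_less_1:
  assumes "b \<in> qPA1_B" "Lam \<in> qPA1_L0 b"
  shows "norm (q1 Lam b) < 1" "norm (q2 Lam b) < 1"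
proof -
  have "Lam \<noteq> 0" "norm (b 1 * b 2 * b 3 * b 4) < norm Lam ^ 2"
    "norm Lam ^ 2 < norm (b 5 * b 6 * b 7 * b 8)"
    using assms(2) unfolding qPA1_L0_def by auto
  then show "norm (q1 Lam b) < 1" "norm (q2 Lam b) < 1"
    using qPA1_B_nz[OF assms(1)] assms(1) unfolding q1_eq[OF assms(1)] q2_eq
    by (simp_all add: norm_divide norm_power norm_mult divide_less_eq)
qed

text \<open>One factor \<rho> is kept and the others are dropped: the purpose is only to keep all
  nontrivial products uniformly away from 1.\<close>

lemma norm_powers_le:
  fixes a c :: complex
  assumes "norm a \<le> \<rho>" "norm c \<le> \<rho>" "\<rho> \<le> 1" "(n, m) \<noteq> (0, 0)"
  shows "norm (a ^ n * c ^ m) \<le> \<rho>"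
proof -
  have "0 \<le> \<rho>" using assms(1) norm_ge_zero order_trans by blast
  have "norm (a ^ n * c ^ m) \<le> \<rho> ^ n * \<rho> ^ m"
    unfolding norm_mult norm_power
    using assms \<open>0 \<le> \<rho>\<close> by (intro mult_mono power_mono) auto
  also have "\<dots> = \<rho> ^ (n + m)" by (simp add: power_add)
  also have "\<dots> \<le> \<rho> ^ 1"
    using assms \<open>0 \<le> \<rho>\<close> by (intro power_decreasing) auto
  finally show ?thesis by simp
qed

lemma L0_subset_good:
  assumes "b \<in> qPA1_B" "Lam \<in> qPA1_L0 b"
  shows "(Lam, b) \<in> qPA1_good"
proof -
  have "1 \<notin> qPA1_Q Lam b"
  proof
    assume "1 \<in> qPA1_Q Lam b"
    then obtain m n where mn: "(m, n) \<noteq> (0, 0)" "q1 Lam b ^ m * q2 Lam b ^ n = 1"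
      unfolding qPA1_Q_def q1_def q2_def by auto
    define \<rho> where "\<rho> = max (norm (q1 Lam b)) (norm (q2 Lam b))"
    have "\<rho> < 1" unfolding \<rho>_def using L0_norm_less_1[OF assms] by auto
    then have "norm (q1 Lam b ^ m * q2 Lam b ^ n) \<le> \<rho>"
      by (intro norm_powers_le mn) (auto simp: \<rho>_def)
    then show False using mn \<open>\<rho> < 1\<close> by simp
  qed
  then show ?thesis using assms unfolding qPA1_good_def qPA1_L0_def by auto
qed

definition compact_in_L0 :: "(nat \<Rightarrow> complex) \<Rightarrow> complex set \<Rightarrow> bool" where
  "compact_in_L0 b V \<longleftrightarrow> b \<in> qPA1_B \<and> compact V \<and> V \<subseteq> qPA1_L0 b"

lemma compact_in_L0_good: "compact_in_L0 b V \<Longrightarrow> Lam \<in> V \<Longrightarrow> (Lam, b) \<in> qPA1_good"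
  unfolding compact_in_L0_def using L0_subset_good by blast

text \<open>On a nonempty compact set the maximum of both norms is attained, so the pointwise strict
  inequality becomes uniform.\<close>

lemma compact_in_L0_contraction:
  assumes "compact_in_L0 b V"
  obtains \<rho> where "0 \<le> \<rho>" "\<rho> < 1" "\<And>Lam. Lam \<in> V \<Longrightarrow> norm (q1 Lam b) \<le> \<rho>"
    "\<And>Lam. Lam \<in> V \<Longrightarrow> norm (q2 Lam b) \<le> \<rho>"
proof (cases "V = {}")
  case True
  then show ?thesis using that[of 0] by auto
next
  case False
  have V: "compact V" "V \<subseteq> qPA1_L0 b" "b \<in> qPA1_B"
    using assms by (auto simp: compact_in_L0_def)
  define h where "h Lam = max (norm (q1 Lam b)) (norm (q2 Lam b))" for Lam
  have "continuous_on V h"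
    unfolding h_def using compact_in_L0_good[OF assms]
    by (intro continuous_intros holomorphic_on_imp_continuous_on rational_holomorphic
        rational_q1 rational_q2)
  then obtain L where L: "L \<in> V" "\<And>Lam. Lam \<in> V \<Longrightarrow> h Lam \<le> h L"
    using continuous_attains_sup[OF V(1) False] by blast
  have "h L < 1"
    using L0_norm_less_1[OF V(3)] V(2) L(1) by (auto simp: h_def)
  moreover have "0 \<le> h L" by (simp add: h_def le_max_iff_disj)
  ultimately show ?thesis
    using that[of "h L"] L(2) by (simp add: h_def)
qed

text \<open>The two demands serve the two halves of the theorem: rationality of each coefficient,
  and a bound independent of \<open>n\<close> and \<open>m\<close>, which expresses the absence of
  small divisors on compact parts of \<open>qPA1_L0\<close>.\<close>

definition multiplier :: "(nat \<Rightarrow> nat \<Rightarrow> complex \<Rightarrow> (nat \<Rightarrow> complex) \<Rightarrow> complex) \<Rightarrow> bool" where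
  "multiplier k \<longleftrightarrow> (\<forall>n m. rational (k n m)) \<and>
     (\<forall>b V. compact_in_L0 b V \<longrightarrow> (\<exists>C. \<forall>Lam\<in>V. \<forall>n m. norm (k n m Lam b) \<le> C))"

lemma multiplier_const: "rational c \<Longrightarrow> multiplier (\<lambda>n m. c)"
  unfolding multiplier_def using rational_bounded compact_in_L0_good
  by (metis compact_in_L0_def)

lemma multiplier_shift_factor: "multiplier shift_factor"
  unfolding multiplier_def
proof (intro conjI allI impI rational_shift_factor)
  fix b V assume V: "compact_in_L0 b V"
  obtain \<rho> where \<rho>: "\<rho> < 1" "\<And>Lam. Lam \<in> V \<Longrightarrow> norm (q1 Lam b) \<le> \<rho>"
    "\<And>Lam. Lam \<in> V \<Longrightarrow> norm (q2 Lam b) \<le> \<rho>"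
    using compact_in_L0_contraction[OF V] by metis
  have "norm (shift_factor n m Lam b) \<le> 1" if "Lam \<in> V" for Lam n m
    using norm_powers_le[of "q1 Lam b" 1 "q2 Lam b" n m] \<rho>(1) \<rho>(2,3)[OF that]
    by (cases "(n, m) = (0, 0)") (auto simp: shift_factor_def)
  then show "\<exists>C. \<forall>Lam\<in>V. \<forall>n m. norm (shift_factor n m Lam b) \<le> C" by blast
qed

lemma multiplier_mult:
  assumes "multiplier k" "multiplier l"
  shows "multiplier (\<lambda>n m Lam b. k n m Lam b * l n m Lam b)"
  unfolding multiplier_def
proof (intro conjI allI impI)
  show "rational (\<lambda>Lam b. k n m Lam b * l n m Lam b)" for n m
    using assms by (intro rational_mult) (auto simp: multiplier_def)
  fix b V assume "compact_in_L0 b V"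
  then obtain C D where "\<forall>Lam\<in>V. \<forall>n m. norm (k n m Lam b) \<le> C"
    "\<forall>Lam\<in>V. \<forall>n m. norm (l n m Lam b) \<le> D"
    using assms unfolding multiplier_def by meson
  \<comment> \<open>Absolute values, because an empty \<open>V\<close> leaves the signs of
    \<open>C\<close> and \<open>D\<close> undetermined.\<close>
  then have "\<forall>Lam\<in>V. \<forall>n m. norm (k n m Lam b * l n m Lam b) \<le> \<bar>C\<bar> * \<bar>D\<bar>"
    unfolding norm_mult by (intro ballI allI mult_mono) (auto intro: order_trans[OF _ abs_ge_self])
  then show "\<exists>C. \<forall>Lam\<in>V. \<forall>n m. norm (k n m Lam b * l n m Lam b) \<le> C" by blast
qed

lemma multiplier_add:
  assumes "multiplier k" "multiplier l"
  shows "multiplier (\<lambda>n m Lam b. k n m Lam b + l n m Lam b)"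
  unfolding multiplier_def
proof (intro conjI allI impI)
  show "rational (\<lambda>Lam b. k n m Lam b + l n m Lam b)" for n m
    using assms by (intro rational_add) (auto simp: multiplier_def)
  fix b V assume "compact_in_L0 b V"
  then obtain C D where "\<forall>Lam\<in>V. \<forall>n m. norm (k n m Lam b) \<le> C"
    "\<forall>Lam\<in>V. \<forall>n m. norm (l n m Lam b) \<le> D"
    using assms unfolding multiplier_def by meson
  then have "\<forall>Lam\<in>V. \<forall>n m. norm (k n m Lam b + l n m Lam b) \<le> C + D"
    by (meson add_mono norm_triangle_ineq order_trans)
  then show "\<exists>C. \<forall>Lam\<in>V. \<forall>n m. norm (k n m Lam b + l n m Lam b) \<le> C" by blast
qed

text \<open>At \<open>(0, 0)\<close> the shift factor is 1 and there is nothing to invert. The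
  default 0 meets only a vanishing constant coefficient when \<open>x\<close> and \<open>y\<close>
  have no constant term.\<close>

definition resolvent :: "nat \<Rightarrow> nat \<Rightarrow> complex \<Rightarrow> (nat \<Rightarrow> complex) \<Rightarrow> complex" where
  "resolvent n m Lam b = (if (n, m) = (0, 0) then 0 else inverse (1 - shift_factor n m Lam b))"

lemma multiplier_resolvent: "multiplier resolvent"
  unfolding multiplier_def
proof (intro conjI allI impI)
  show "rational (resolvent n m)" for n m
  proof (cases "(n, m) = (0, 0)")
    case True
    then show ?thesis using rational_const[of 0] by (simp add: resolvent_def[abs_def])
  next
    case False
    have "rational (\<lambda>Lam b. inverse (1 - shift_factor n m Lam b))"
      using shift_factor_neq_1[OF _ False]
      by (intro rational_inverse rational_diff rational_const rational_shift_factor) auto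
    then show ?thesis by (rule rational_cong) (use False in \<open>auto simp: resolvent_def\<close>)
  qed
  fix b V assume V: "compact_in_L0 b V"
  obtain \<rho> where \<rho>: "0 \<le> \<rho>" "\<rho> < 1" "\<And>Lam. Lam \<in> V \<Longrightarrow> norm (q1 Lam b) \<le> \<rho>"
    "\<And>Lam. Lam \<in> V \<Longrightarrow> norm (q2 Lam b) \<le> \<rho>"
    using compact_in_L0_contraction[OF V] by metis
  have "norm (resolvent n m Lam b) \<le> inverse (1 - \<rho>)" if "Lam \<in> V" for Lam n m
  proof (cases "(n, m) = (0, 0)")
    case False
    have "norm (shift_factor n m Lam b) \<le> \<rho>"
      unfolding shift_factor_def using \<rho> that False by (intro norm_powers_le) auto
    then have "1 - \<rho> \<le> norm (1 - shift_factor n m Lam b)"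
      using norm_triangle_ineq2[of 1 "shift_factor n m Lam b"] by simp
    then have "inverse (norm (1 - shift_factor n m Lam b)) \<le> inverse (1 - \<rho>)"
      using \<rho>(2) by (intro le_imp_inverse_le) auto
    then show ?thesis using False by (auto simp: resolvent_def norm_inverse)
  qed (use \<rho> in \<open>auto simp: resolvent_def\<close>)
  then show "\<exists>C. \<forall>Lam\<in>V. \<forall>n m. norm (resolvent n m Lam b) \<le> C" by blast
qed

subsection \<open>Power series in two variables\<close>

text \<open>The outer variable is \<open>z1\<close>, the inner one \<open>z2\<close>. Nested power
  series over a field form an integral domain, which later allows a power of \<open>Z1\<close> to be
  cancelled.\<close>

definition coeff2 :: "complex fps fps \<Rightarrow> nat \<Rightarrow> nat \<Rightarrow> complex" where
  "coeff2 A n m = fps_nth (fps_nth A n) m"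

definition series2 :: "(nat \<Rightarrow> nat \<Rightarrow> complex) \<Rightarrow> complex fps fps" where
  "series2 a = Abs_fps (\<lambda>n. Abs_fps (a n))"

definition const2 :: "complex \<Rightarrow> complex fps fps" where
  "const2 c = fps_const (fps_const c)"

definition Z1 :: "complex fps fps" where "Z1 = fps_X"
definition Z2 :: "complex fps fps" where "Z2 = fps_const fps_X"

definition diag :: "(nat \<Rightarrow> nat \<Rightarrow> complex) \<Rightarrow> complex fps fps \<Rightarrow> complex fps fps" where
  "diag k A = series2 (\<lambda>n m. k n m * coeff2 A n m)"

lemma series2_eqI: "(\<And>n m. coeff2 A n m = coeff2 B n m) \<Longrightarrow> A = B"
  unfolding coeff2_def by (simp add: fps_eq_iff)

lemma coeff2_series2 [simp]: "coeff2 (series2 a) n m = a n m"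
  by (simp add: coeff2_def series2_def)

lemma coeff2_simps [simp]:
  "coeff2 0 n m = 0"
  "coeff2 1 n m = (if n = 0 \<and> m = 0 then 1 else 0)"
  "coeff2 (A + B) n m = coeff2 A n m + coeff2 B n m"
  "coeff2 (A - B) n m = coeff2 A n m - coeff2 B n m"
  "coeff2 (- A) n m = - coeff2 A n m"
  "coeff2 (const2 c * A) n m = c * coeff2 A n m"
  "coeff2 (Z1 * A) n m = (if n = 0 then 0 else coeff2 A (n - 1) m)"
  "coeff2 (Z2 * A) n m = (if m = 0 then 0 else coeff2 A n (m - 1))"
  "coeff2 (diag k A) n m = k n m * coeff2 A n m"
  by (auto simp: coeff2_def const2_def diag_def Z1_def Z2_def series2_def)

lemma coeff2_double [simp]: "coeff2 (2 * A) n m = 2 * coeff2 A n m"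
  by (simp only: mult_2 coeff2_simps)

lemma coeff2_mult:
  "coeff2 (A * B) n m = (\<Sum>i=0..n. \<Sum>j=0..m. coeff2 A i j * coeff2 B (n - i) (m - j))"
  by (simp add: coeff2_def fps_mult_nth fps_sum_nth)

lemma coeff2_Z [simp]:
  "coeff2 Z1 n m = (if n = 1 \<and> m = 0 then 1 else 0)"
  "coeff2 Z2 n m = (if n = 0 \<and> m = 1 then 1 else 0)"
  by (auto simp: coeff2_def Z1_def Z2_def)

lemma coeff2_const2 [simp]: "coeff2 (const2 c) n m = (if n = 0 \<and> m = 0 then c else 0)"
  by (simp add: coeff2_def const2_def)

lemma const2_hom:
  "const2 0 = 0" "const2 1 = 1"
  "const2 (c + d) = const2 c + const2 d"
  "const2 (c - d) = const2 c - const2 d"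
  "const2 (c * d) = const2 c * const2 d"
  "const2 (- c) = - const2 c"
  "const2 (c ^ n) = const2 c ^ n"
  by (auto simp: const2_def fps_const_neg[symmetric] simp del: fps_const_neg)

lemma const2_inject: "const2 c = const2 d \<longleftrightarrow> c = d"
  by (simp add: const2_def)

lemma diag_const2_mult: "diag k (const2 c * A) = const2 c * diag k A"
  by (rule series2_eqI) simp

text \<open>This is the \<open>K\<close>-th power of the ideal generated by \<open>Z1\<close> and
  \<open>Z2\<close>; the Picard iteration converges in the corresponding adic topology.\<close>

definition order_ge :: "nat \<Rightarrow> complex fps fps set" where
  "order_ge K = {A. \<forall>n m. n + m < K \<longrightarrow> coeff2 A n m = 0}"

lemma order_geD: "A \<in> order_ge K \<Longrightarrow> n + m < K \<Longrightarrow> coeff2 A n m = 0"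
  unfolding order_ge_def by auto

lemma order_ge_0 [simp]: "A \<in> order_ge 0" "0 \<in> order_ge K"
  by (auto simp: order_ge_def)

lemma order_ge_mono: "A \<in> order_ge K \<Longrightarrow> J \<le> K \<Longrightarrow> A \<in> order_ge J"
  unfolding order_ge_def by auto

lemma order_ge_add: "A \<in> order_ge K \<Longrightarrow> B \<in> order_ge K \<Longrightarrow> A + B \<in> order_ge K"
  unfolding order_ge_def by auto

lemma order_ge_diag: "A \<in> order_ge K \<Longrightarrow> diag k A \<in> order_ge K"
  unfolding order_ge_def by auto

lemma order_ge_mult:
  assumes "A \<in> order_ge J" "B \<in> order_ge K"
  shows "A * B \<in> order_ge (J + K)"
  unfolding order_ge_def
proof (intro CollectI allI impI)
  fix n m :: nat assume *: "n + m < J + K"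
  have "coeff2 A i j * coeff2 B (n - i) (m - j) = 0" if "i \<le> n" "j \<le> m" for i j
  proof (cases "i + j < J")
    case True
    then show ?thesis using order_geD[OF assms(1)] by simp
  next
    case False
    then have "(n - i) + (m - j) < K" using that * by linarith
    then show ?thesis using order_geD[OF assms(2)] by simp
  qed
  then show "coeff2 (A * B) n m = 0"
    unfolding coeff2_mult by (intro sum.neutral ballI) auto
qed

lemma order_ge_all_eq:
  assumes "\<And>K. A - B \<in> order_ge K"
  shows "A = B"
proof (rule series2_eqI)
  fix n m
  show "coeff2 A n m = coeff2 B n m"
    using order_geD[OF assms[of "Suc (n + m)"], of n m] by simp
qed

subsection \<open>A truncated weighted norm\<close>

text \<open>The truncation at \<open>M\<close> makes every series finite, so that bounds uniform in \<open>M\<close> can be proved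
  before any convergence is known.\<close>

definition trunc_norm :: "nat \<Rightarrow> real \<Rightarrow> complex fps fps \<Rightarrow> real" where
  "trunc_norm M r A = (\<Sum>n\<le>M. \<Sum>m\<le>M. norm (coeff2 A n m) * r ^ (n + m))"

lemma trunc_norm_nonneg: "0 \<le> r \<Longrightarrow> 0 \<le> trunc_norm M r A"
  unfolding trunc_norm_def by (intro sum_nonneg) auto

lemma trunc_norm_add: "0 \<le> r \<Longrightarrow> trunc_norm M r (A + B) \<le> trunc_norm M r A + trunc_norm M r B"
  unfolding trunc_norm_def sum.distrib[symmetric]
  by (intro sum_mono) (simp add: norm_triangle_ineq mult_right_mono flip: distrib_right)

lemma trunc_norm_diag:
  assumes "0 \<le> r" "\<And>n m. norm (k n m) \<le> C"
  shows "trunc_norm M r (diag k A) \<le> C * trunc_norm M r A"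
  unfolding trunc_norm_def sum_distrib_left
  using assms by (intro sum_mono) (simp add: norm_mult mult_right_mono mult.assoc[symmetric])

text \<open>The pairs \<open>(i, n - i)\<close> fill a triangle inside the square of side
  \<open>M\<close>, and all terms are nonnegative.\<close>

lemma sum_triangle_product_le:
  fixes a c :: "nat \<Rightarrow> real"
  assumes "\<And>i. 0 \<le> a i" "\<And>i. 0 \<le> c i"
  shows "(\<Sum>n\<le>M. \<Sum>i=0..n. a i * c (n - i)) \<le> (\<Sum>n\<le>M. a n) * (\<Sum>n\<le>M. c n)"
proof -
  have "(\<Sum>n\<le>M. \<Sum>i=0..n. a i * c (n - i)) = (\<Sum>(n, i)\<in>(SIGMA n:{..M}. {0..n}). a i * c (n - i))"
    by (simp add: sum.Sigma)
  also have "\<dots> = (\<Sum>(i, j)\<in>(\<lambda>(n, i). (i, n - i)) ` (SIGMA n:{..M}. {0..n}). a i * c j)"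
    by (subst sum.reindex) (auto simp: inj_on_def split_beta)
  also have "\<dots> \<le> (\<Sum>(i, j)\<in>{..M} \<times> {..M}. a i * c j)"
    using assms by (intro sum_mono2) (auto intro: mult_nonneg_nonneg)
  also have "\<dots> = (\<Sum>n\<le>M. a n) * (\<Sum>n\<le>M. c n)"
    by (simp add: sum_product sum.cartesian_product)
  finally show ?thesis .
qed

text \<open>Truncation is harmless because a coefficient of a product with both indices at most
  \<open>M\<close> involves only such coefficients of the factors. The triangle estimate is used
  once in the inner index and once in the outer one.\<close>

lemma trunc_norm_mult:
  assumes "0 \<le> r"
  shows "trunc_norm M r (A * B) \<le> trunc_norm M r A * trunc_norm M r B"
proof -
  define w where "w A n m = norm (coeff2 A n m) * r ^ (n + m)" for A n m
  have w: "0 \<le> w A n m" for A n m using assms by (simp add: w_def)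
  have "trunc_norm M r (A * B) \<le>
    (\<Sum>n\<le>M. \<Sum>m\<le>M. \<Sum>i=0..n. \<Sum>j=0..m. w A i j * w B (n - i) (m - j))"
    unfolding trunc_norm_def
  proof (intro sum_mono)
    fix n m
    have "norm (coeff2 (A * B) n m) * r ^ (n + m) \<le>
      (\<Sum>i=0..n. \<Sum>j=0..m. norm (coeff2 A i j) * norm (coeff2 B (n - i) (m - j))) * r ^ (n + m)"
      unfolding coeff2_mult norm_mult[symmetric] using assms
      by (intro mult_right_mono sum_norm_le) auto
    also have "\<dots> = (\<Sum>i=0..n. \<Sum>j=0..m. w A i j * w B (n - i) (m - j))"
      unfolding sum_distrib_right
    proof (intro sum.cong refl)
      fix i j assume "i \<in> {0..n}" "j \<in> {0..m}"
      then have "r ^ (n + m) = r ^ (i + j) * r ^ (n - i + (m - j))"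
        by (simp flip: power_add)
      then show "norm (coeff2 A i j) * norm (coeff2 B (n - i) (m - j)) * r ^ (n + m) =
          w A i j * w B (n - i) (m - j)"
        by (simp add: w_def)
    qed
    finally show "norm (coeff2 (A * B) n m) * r ^ (n + m) \<le>
      (\<Sum>i=0..n. \<Sum>j=0..m. w A i j * w B (n - i) (m - j))" .
  qed
  also have "\<dots> = (\<Sum>n\<le>M. \<Sum>i=0..n. \<Sum>m\<le>M. \<Sum>j=0..m. w A i j * w B (n - i) (m - j))"
    by (intro sum.cong refl sum.swap)
  also have "\<dots> \<le> (\<Sum>n\<le>M. \<Sum>i=0..n. (\<Sum>m\<le>M. w A i m) * (\<Sum>m\<le>M. w B (n - i) m))"
    by (intro sum_mono sum_triangle_product_le w)
  also have "\<dots> \<le> (\<Sum>n\<le>M. \<Sum>m\<le>M. w A n m) * (\<Sum>n\<le>M. \<Sum>m\<le>M. w B n m)"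
    by (intro sum_triangle_product_le sum_nonneg w)
  finally show ?thesis by (simp add: trunc_norm_def w_def)
qed

text \<open>The level \<open>n + m\<close> is just one that contains the index pair
  \<open>(n, m)\<close>.\<close>

lemma trunc_norm_coeff2:
  assumes "0 < r" "trunc_norm (n + m) r A \<le> d"
  shows "norm (coeff2 A n m) \<le> d / r ^ (n + m)"
proof -
  have "norm (coeff2 A n m) * r ^ (n + m) \<le> (\<Sum>j\<le>n + m. norm (coeff2 A n j) * r ^ (n + j))"
    by (rule member_le_sum) (use assms in auto)
  also have "\<dots> \<le> trunc_norm (n + m) r A"
    unfolding trunc_norm_def
    by (rule member_le_sum[where f = "\<lambda>i. \<Sum>j\<le>n + m. norm (coeff2 A i j) * r ^ (i + j)"])
       (use assms in \<open>auto intro!: sum_nonneg\<close>)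
  finally show ?thesis using assms by (simp add: field_simps)
qed

lemma trunc_norm_Z:
  assumes "0 \<le> r"
  shows "trunc_norm M r Z1 \<le> r" "trunc_norm M r Z2 \<le> r"
proof -
  have "trunc_norm M r Z1 = (\<Sum>n\<le>M. \<Sum>m\<le>M. if m = 0 then (if n = 1 then r else 0) else 0)"
    unfolding trunc_norm_def by (intro sum.cong) auto
  then show "trunc_norm M r Z1 \<le> r" using assms by simp
  have "trunc_norm M r Z2 = (\<Sum>n\<le>M. \<Sum>m\<le>M. if m = 1 then (if n = 0 then r else 0) else 0)"
    unfolding trunc_norm_def by (intro sum.cong) auto
  also have "\<dots> = (if 1 \<le> M then \<Sum>n\<le>M. if n = 0 then r else 0 else 0)"
    by simp
  finally show "trunc_norm M r Z2 \<le> r" using assms by simp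
qed

subsection \<open>Admissible operators\<close>

type_synonym operator2 =
  "complex \<Rightarrow> (nat \<Rightarrow> complex) \<Rightarrow> complex fps fps \<Rightarrow> complex fps fps \<Rightarrow> complex fps fps"

text \<open>Operators of level 2 are those without a term linear in \<open>(x, y)\<close>, up to terms that carry a
  factor \<open>Z1\<close> or \<open>Z2\<close>; they improve the order of a difference and are small near \<open>0\<close>.\<close>

inductive admissible :: "nat \<Rightarrow> operator2 \<Rightarrow> bool" where
  admissible_fst: "admissible 1 (\<lambda>L b x y. x)"
| admissible_snd: "admissible 1 (\<lambda>L b x y. y)"
| admissible_zero: "admissible 2 (\<lambda>L b x y. 0)"
| admissible_Z1: "admissible 2 (\<lambda>L b x y. Z1)"
| admissible_Z2: "admissible 2 (\<lambda>L b x y. Z2)"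
| admissible_weaken: "admissible 2 T \<Longrightarrow> admissible 1 T"
| admissible_add: "admissible j S \<Longrightarrow> admissible j T \<Longrightarrow> admissible j (\<lambda>L b x y. S L b x y + T L b x y)"
| admissible_mult: "admissible 1 S \<Longrightarrow> admissible 1 T \<Longrightarrow> admissible 2 (\<lambda>L b x y. S L b x y * T L b x y)"
| admissible_diag: "multiplier k \<Longrightarrow> admissible j T \<Longrightarrow>
    admissible j (\<lambda>L b x y. diag (\<lambda>n m. k n m L b) (T L b x y))"

text \<open>No rule of \<open>admissible\<close> introduces a nonzero constant, so no constant term
  can arise.\<close>

lemma admissible_order_ge_1:
  assumes "admissible j T" "x \<in> order_ge 1" "y \<in> order_ge 1"
  shows "T L b x y \<in> order_ge 1"
  using assms
proof (induction rule: admissible.induct)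
  case (admissible_mult S T)
  then show ?case using order_ge_mult[of "S L b x y" 1 "T L b x y" 1]
    by (auto intro: order_ge_mono)
qed (auto intro: order_ge_add order_ge_diag, auto simp: order_ge_def)

text \<open>Level 1 preserves the order of a difference and level 2 gains one. The gain comes from
  products: with \<open>S'\<close>, \<open>T'\<close> the values at \<open>x'\<close>,
  \<open>y'\<close>, one has \<open>S * T - S' * T' = S * (T - T') + (S - S') * T'\<close>, where
  \<open>S\<close> and \<open>T'\<close> have order at least 1.\<close>

lemma admissible_difference:
  assumes "admissible j T" "x \<in> order_ge 1" "y \<in> order_ge 1" "x' \<in> order_ge 1" "y' \<in> order_ge 1"
    and "x - x' \<in> order_ge K" "y - y' \<in> order_ge K"
  shows "T L b x y - T L b x' y' \<in> order_ge (K + j - 1)"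
  using assms
proof (induction rule: admissible.induct)
  case (admissible_weaken T)
  then show ?case using order_ge_mono[of _ "K + 2 - 1" "K + 1 - 1"] by simp
next
  case (admissible_add j S T)
  have "(S L b x y - S L b x' y') + (T L b x y - T L b x' y') \<in> order_ge (K + j - 1)"
    using admissible_add by (intro order_ge_add) auto
  then show ?case by (simp add: algebra_simps)
next
  case (admissible_mult S T)
  have "S L b x y \<in> order_ge 1" "T L b x' y' \<in> order_ge 1"
    using admissible_mult admissible_order_ge_1 by blast+
  moreover have "S L b x y - S L b x' y' \<in> order_ge K" "T L b x y - T L b x' y' \<in> order_ge K"
    using admissible_mult by simp_all
  ultimately have "S L b x y * (T L b x y - T L b x' y') \<in> order_ge (1 + K)"
    "(S L b x y - S L b x' y') * T L b x' y' \<in> order_ge (K + 1)"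
    using order_ge_mult by blast+
  then have "S L b x y * (T L b x y - T L b x' y') + (S L b x y - S L b x' y') * T L b x' y' \<in> order_ge (K + 1)"
    by (intro order_ge_add) (auto simp: add.commute)
  then show ?case by (simp add: algebra_simps)
next
  case (admissible_diag k j T)
  have "diag (\<lambda>n m. k n m L b) (T L b x y - T L b x' y') \<in> order_ge (K + j - 1)"
    using admissible_diag by (intro order_ge_diag) auto
  also have "diag (\<lambda>n m. k n m L b) (T L b x y - T L b x' y') =
      diag (\<lambda>n m. k n m L b) (T L b x y) - diag (\<lambda>n m. k n m L b) (T L b x' y')"
    by (rule series2_eqI) (simp add: algebra_simps)
  finally show ?case .
qed auto

lemma admissible_rational:
  assumes "admissible j T" "\<And>n m. rational (\<lambda>L b. coeff2 (x L b) n m)"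
    "\<And>n m. rational (\<lambda>L b. coeff2 (y L b) n m)"
  shows "rational (\<lambda>L b. coeff2 (T L b (x L b) (y L b)) n m)"
  using assms
proof (induction arbitrary: n m rule: admissible.induct)
  case (admissible_mult S T)
  then show ?case unfolding coeff2_mult by (intro rational_sum rational_mult) auto
next
  case (admissible_diag k j T)
  then show ?case by (auto simp: multiplier_def intro: rational_mult)
qed (auto intro: rational_const rational_add)

text \<open>The term \<open>r\<close> pays for a factor \<open>Z1\<close> or \<open>Z2\<close>,
  whose norm is at most \<open>r\<close>; the term \<open>d ^ j\<close> pays for degree
  \<open>j\<close> in \<open>(x, y)\<close>. The constant does not depend on
  \<open>M\<close>.\<close>

definition growth_bound :: "operator2 \<Rightarrow> (nat \<Rightarrow> complex) \<Rightarrow> complex set \<Rightarrow> nat \<Rightarrow> real \<Rightarrow> bool" where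
  "growth_bound T b V j C \<longleftrightarrow> (\<forall>L\<in>V. \<forall>r d M x y. 0 \<le> r \<and> r \<le> 1 \<and> 0 \<le> d \<and> d \<le> 1 \<and>
      trunc_norm M r x \<le> d \<and> trunc_norm M r y \<le> d \<longrightarrow> trunc_norm M r (T L b x y) \<le> C * (r + d ^ j))"

lemma growth_boundD:
  assumes "growth_bound T b V j C" "L \<in> V" "0 \<le> r" "r \<le> 1" "0 \<le> d" "d \<le> 1"
    "trunc_norm M r x \<le> d" "trunc_norm M r y \<le> d"
  shows "trunc_norm M r (T L b x y) \<le> C * (r + d ^ j)"
  using assms unfolding growth_bound_def by blast

lemma admissible_bound:
  assumes "admissible j T" and V: "compact_in_L0 b V"
  shows "\<exists>C\<ge>0. growth_bound T b V j C"
  using assms(1)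
proof (induction rule: admissible.induct)
  case admissible_fst
  then show ?case by (intro exI[of _ 1]) (auto simp: growth_bound_def)
next
  case admissible_snd
  then show ?case by (intro exI[of _ 1]) (auto simp: growth_bound_def)
next
  case admissible_zero
  then show ?case by (intro exI[of _ 0]) (auto simp: growth_bound_def trunc_norm_def)
next
  case admissible_Z1
  then show ?case by (intro exI[of _ 1]) (auto simp: growth_bound_def intro: order_trans[OF trunc_norm_Z(1)])
next
  case admissible_Z2
  then show ?case by (intro exI[of _ 1]) (auto simp: growth_bound_def intro: order_trans[OF trunc_norm_Z(2)])
next
  case (admissible_weaken T)
  then obtain C where C: "C \<ge> 0" "growth_bound T b V 2 C" by blast
  have "C * (r + d ^ 2) \<le> C * (r + d ^ 1)" if "0 \<le> d" "d \<le> 1" for r d :: real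
    using that C(1) by (intro mult_left_mono add_left_mono power_decreasing) auto
  then have "growth_bound T b V 1 C"
    unfolding growth_bound_def using growth_boundD[OF C(2)] by (meson order_trans)
  then show ?case using C(1) by blast
next
  case (admissible_add j S T)
  then obtain C where C: "C \<ge> 0" "growth_bound S b V j C" by blast
  from admissible_add obtain D where D: "D \<ge> 0" "growth_bound T b V j D" by blast
  show ?case
    using C(1) D(1) order_trans[OF trunc_norm_add add_mono[OF growth_boundD[OF C(2)] growth_boundD[OF D(2)]]]
    by (intro exI[of _ "C + D"]) (auto simp: growth_bound_def distrib_right)
next
  case (admissible_mult S T)
  then obtain C where C: "C \<ge> 0" "growth_bound S b V 1 C" by blast
  from admissible_mult obtain D where D: "D \<ge> 0" "growth_bound T b V 1 D" by blast
  have "trunc_norm M r (S L b x y * T L b x y) \<le> (3 * C * D) * (r + d ^ 2)"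
    if "L \<in> V" "0 \<le> r" "r \<le> 1" "0 \<le> d" "d \<le> 1" "trunc_norm M r x \<le> d" "trunc_norm M r y \<le> d"
    for L r d M x y
  proof -
    have "trunc_norm M r (S L b x y * T L b x y) \<le> trunc_norm M r (S L b x y) * trunc_norm M r (T L b x y)"
      using that by (intro trunc_norm_mult)
    also have "\<dots> \<le> (C * (r + d ^ 1)) * (D * (r + d ^ 1))"
      using C(1) D(1) that trunc_norm_nonneg growth_boundD[OF C(2)] growth_boundD[OF D(2)]
      by (intro mult_mono) auto
    also have "\<dots> = C * D * ((r + d) ^ 2)" by (simp add: power2_eq_square)
    \<comment> \<open>Since \<open>r\<close> and \<open>d\<close> are at most 1, both
      \<open>r * r\<close> and \<open>r * d\<close> are at most \<open>r\<close>; this gives the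
      factor 3.\<close>
    also have "\<dots> \<le> C * D * (3 * (r + d ^ 2))"
    proof (rule mult_left_mono)
      have "r * r \<le> r" "r * d \<le> r" using that mult_left_mono[of _ 1 r] by auto
      then have "r * r + 2 * (r * d) + d ^ 2 \<le> r + 2 * r + 3 * d ^ 2"
        by (intro add_mono) auto
      then show "(r + d) ^ 2 \<le> 3 * (r + d ^ 2)" by (simp add: power2_eq_square algebra_simps)
    qed (use C(1) D(1) in simp)
    finally show ?thesis by (simp add: algebra_simps)
  qed
  then show ?case using C(1) D(1) by (intro exI[of _ "3 * C * D"]) (auto simp: growth_bound_def)
next
  case (admissible_diag k j T)
  then obtain C where C: "C \<ge> 0" "growth_bound T b V j C" by blast
  obtain D where D: "\<forall>L\<in>V. \<forall>n m. norm (k n m L b) \<le> D"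
    using admissible_diag(1) V unfolding multiplier_def by blast
  have "trunc_norm M r (diag (\<lambda>n m. k n m L b) (T L b x y)) \<le> (\<bar>D\<bar> * C) * (r + d ^ j)"
    if "L \<in> V" "0 \<le> r" "r \<le> 1" "0 \<le> d" "d \<le> 1" "trunc_norm M r x \<le> d" "trunc_norm M r y \<le> d"
    for L r d M x y
  proof -
    have "trunc_norm M r (diag (\<lambda>n m. k n m L b) (T L b x y)) \<le> \<bar>D\<bar> * trunc_norm M r (T L b x y)"
      using that D by (intro trunc_norm_diag) (auto intro: order_trans[OF _ abs_ge_self])
    also have "\<dots> \<le> \<bar>D\<bar> * (C * (r + d ^ j))"
      using growth_boundD[OF C(2)] that by (intro mult_left_mono) auto
    finally show ?thesis by (simp add: mult.assoc)
  qed
  then show ?case using C(1) by (intro exI[of _ "\<bar>D\<bar> * C"]) (auto simp: growth_bound_def)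
qed

subsection \<open>Fixed points of pairs of admissible operators of level 2\<close>

locale contraction_pair =
  fixes S T :: operator2
  assumes S: "admissible 2 S" and T: "admissible 2 T"
begin

primrec picard :: "complex \<Rightarrow> (nat \<Rightarrow> complex) \<Rightarrow> nat \<Rightarrow> complex fps fps \<times> complex fps fps" where
  "picard L b 0 = (0, 0)"
| "picard L b (Suc k) =
    (S L b (fst (picard L b k)) (snd (picard L b k)), T L b (fst (picard L b k)) (snd (picard L b k)))"

lemma picard_order_ge_1: "fst (picard L b k) \<in> order_ge 1 \<and> snd (picard L b k) \<in> order_ge 1"
proof (induction k)
  case (Suc k)
  then show ?case using admissible_order_ge_1[OF S] admissible_order_ge_1[OF T] by simp
qed simp

lemma improve:
  assumes "x \<in> order_ge 1" "y \<in> order_ge 1" "x' \<in> order_ge 1" "y' \<in> order_ge 1"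
    and "x - x' \<in> order_ge K" "y - y' \<in> order_ge K"
  shows "S L b x y - S L b x' y' \<in> order_ge (Suc K)" "T L b x y - T L b x' y' \<in> order_ge (Suc K)"
  using admissible_difference[OF S assms] admissible_difference[OF T assms] by auto

lemma picard_step:
  "fst (picard L b (Suc k)) - fst (picard L b k) \<in> order_ge (Suc k) \<and>
   snd (picard L b (Suc k)) - snd (picard L b k) \<in> order_ge (Suc k)"
proof (induction k)
  case 0
  then show ?case using picard_order_ge_1[of L b 1] by simp
next
  case (Suc k)
  then show ?case
    using improve[of "fst (picard L b (Suc k))" "snd (picard L b (Suc k))"
        "fst (picard L b k)" "snd (picard L b k)"] picard_order_ge_1[of L b k] picard_order_ge_1[of L b "Suc k"]
    by auto
qed

lemma picard_stable:
  assumes "n + m \<le> k"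
  shows "coeff2 (fst (picard L b k)) n m = coeff2 (fst (picard L b (n + m))) n m \<and>
         coeff2 (snd (picard L b k)) n m = coeff2 (snd (picard L b (n + m))) n m"
  using assms
proof (induction k rule: dec_induct)
  case (step k)
  then show ?case
    using order_geD[OF conjunct1[OF picard_step[of L b k]], of n m]
      order_geD[OF conjunct2[OF picard_step[of L b k]], of n m] by auto
qed auto

text \<open>A diagonal limit: coefficient \<open>(n, m)\<close> is taken from iterate
  \<open>n + m\<close>, from which on it no longer changes. Being a coefficient of a finite iterate,
  it inherits rationality and bounds without any limit argument.\<close>

definition sol1 :: "complex \<Rightarrow> (nat \<Rightarrow> complex) \<Rightarrow> complex fps fps" where
  "sol1 L b = series2 (\<lambda>n m. coeff2 (fst (picard L b (n + m))) n m)"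

definition sol2 :: "complex \<Rightarrow> (nat \<Rightarrow> complex) \<Rightarrow> complex fps fps" where
  "sol2 L b = series2 (\<lambda>n m. coeff2 (snd (picard L b (n + m))) n m)"

lemma sol_approx:
  "sol1 L b - fst (picard L b k) \<in> order_ge (Suc k)" "sol2 L b - snd (picard L b k) \<in> order_ge (Suc k)"
  using picard_stable[of _ _ k L b] by (auto simp: order_ge_def sol1_def sol2_def)

lemma sol_order_ge_1: "sol1 L b \<in> order_ge 1" "sol2 L b \<in> order_ge 1"
  using sol_approx[of L b 0] by auto

text \<open>Iterate \<open>Suc K\<close> agrees to high order with the limit by construction, and
  with the image of the limit because the operators improve the order of agreement of iterate
  \<open>K\<close>. As \<open>K\<close> is arbitrary, limit and image coincide.\<close>

lemma sol_fixed: "sol1 L b = S L b (sol1 L b) (sol2 L b)" "sol2 L b = T L b (sol1 L b) (sol2 L b)"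
proof -
  have *: "sol1 L b - S L b (sol1 L b) (sol2 L b) \<in> order_ge K \<and>
        sol2 L b - T L b (sol1 L b) (sol2 L b) \<in> order_ge K" for K
  proof -
    have "fst (picard L b K) - sol1 L b \<in> order_ge K" "snd (picard L b K) - sol2 L b \<in> order_ge K"
      using sol_approx[of L b K] by (auto simp: order_ge_def)
    then have "fst (picard L b (Suc K)) - S L b (sol1 L b) (sol2 L b) \<in> order_ge (Suc K)"
      "snd (picard L b (Suc K)) - T L b (sol1 L b) (sol2 L b) \<in> order_ge (Suc K)"
      using improve picard_order_ge_1 sol_order_ge_1 by simp_all
    then have
      "(sol1 L b - fst (picard L b (Suc K))) + (fst (picard L b (Suc K)) - S L b (sol1 L b) (sol2 L b)) \<in> order_ge K"
      "(sol2 L b - snd (picard L b (Suc K))) + (snd (picard L b (Suc K)) - T L b (sol1 L b) (sol2 L b)) \<in> order_ge K"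
      using sol_approx[of L b "Suc K"] by (intro order_ge_add; auto elim: order_ge_mono)+
    then show ?thesis by simp
  qed
  show "sol1 L b = S L b (sol1 L b) (sol2 L b)" "sol2 L b = T L b (sol1 L b) (sol2 L b)"
    using * by (auto intro: order_ge_all_eq)
qed

lemma sol_unique:
  assumes "x \<in> order_ge 1" "y \<in> order_ge 1" "x = S L b x y" "y = T L b x y"
  shows "x = sol1 L b" "y = sol2 L b"
proof -
  have *: "x - sol1 L b \<in> order_ge K \<and> y - sol2 L b \<in> order_ge K" for K
  proof (induction K)
    case (Suc K)
    then show ?case
      using improve[of x y "sol1 L b" "sol2 L b" K L b] sol_order_ge_1 assms sol_fixed[of L b] by auto
  qed simp
  show "x = sol1 L b" "y = sol2 L b" using * by (auto intro: order_ge_all_eq)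
qed

lemma sol_rational: "rational (\<lambda>L b. coeff2 (sol1 L b) n m)" "rational (\<lambda>L b. coeff2 (sol2 L b) n m)"
proof -
  have "(\<forall>n m. rational (\<lambda>L b. coeff2 (fst (picard L b k)) n m)) \<and>
        (\<forall>n m. rational (\<lambda>L b. coeff2 (snd (picard L b k)) n m))" for k
  proof (induction k)
    case (Suc k)
    then show ?case using admissible_rational[OF S] admissible_rational[OF T] by simp
  qed (simp add: rational_const)
  then show "rational (\<lambda>L b. coeff2 (sol1 L b) n m)" "rational (\<lambda>L b. coeff2 (sol2 L b) n m)"
    by (auto simp: sol1_def sol2_def)
qed

lemma sol_bound:
  assumes V: "compact_in_L0 b V"
  obtains r where "0 < r" "r \<le> 1"
    "\<And>L n m. L \<in> V \<Longrightarrow> norm (coeff2 (sol1 L b) n m) \<le> 1 / r ^ (n + m)"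
    "\<And>L n m. L \<in> V \<Longrightarrow> norm (coeff2 (sol2 L b) n m) \<le> 1 / r ^ (n + m)"
proof -
  obtain C1 where C1: "growth_bound S b V 2 C1"
    using admissible_bound[OF S V] by blast
  obtain C2 where C2: "growth_bound T b V 2 C2"
    using admissible_bound[OF T V] by blast
  \<comment> \<open>These choices give \<open>C * r = d / 2\<close> and
    \<open>C * d ^ 2 = d / 2\<close>, so the ball of radius \<open>d\<close> is mapped into itself.
    The lower bound 1 on \<open>C\<close> ensures that \<open>d\<close> and \<open>r\<close> are at
    most 1, as \<open>growth_bound\<close> demands.\<close>
  define C where "C = max 1 (max C1 C2)"
  define d where "d = 1 / (2 * C)"
  define r where "r = d / (2 * C)"
  have C: "1 \<le> C" "C1 \<le> C" "C2 \<le> C" by (auto simp: C_def)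
  have d: "0 < d" "d \<le> 1" using C by (auto simp: d_def)
  have r: "0 < r" "r \<le> 1" using C d by (auto simp: r_def divide_le_eq)
  have Crd: "C * (r + d ^ 2) = d"
    using C by (simp add: r_def d_def power2_eq_square field_simps)
  have bd: "trunc_norm M r (fst (picard L b k)) \<le> d \<and> trunc_norm M r (snd (picard L b k)) \<le> d"
    if "L \<in> V" for L k M
  proof (induction k)
    case 0
    then show ?case using d by (simp add: trunc_norm_def)
  next
    case (Suc k)
    have "trunc_norm M r (fst (picard L b (Suc k))) \<le> C1 * (r + d ^ 2)"
      "trunc_norm M r (snd (picard L b (Suc k))) \<le> C2 * (r + d ^ 2)"
      using Suc growth_boundD[OF C1] growth_boundD[OF C2] that r d by auto
    moreover have "C1 * (r + d ^ 2) \<le> C * (r + d ^ 2)" "C2 * (r + d ^ 2) \<le> C * (r + d ^ 2)"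
      using C r by (intro mult_right_mono; simp)+
    ultimately show ?case using Crd by linarith
  qed
  have "norm (coeff2 (sol1 L b) n m) \<le> 1 / r ^ (n + m) \<and> norm (coeff2 (sol2 L b) n m) \<le> 1 / r ^ (n + m)"
    if "L \<in> V" for L n m
    using trunc_norm_coeff2[OF r(1), of n m _ 1] bd[OF that, of "n + m" "n + m"] d(2)
    by (auto simp: sol1_def sol2_def)
  then show ?thesis using that[of r] r by blast
qed

end

subsection \<open>Operators close to one\<close>

lemma admissible_scale:
  assumes "rational c" "admissible j T"
  shows "admissible j (\<lambda>L b x y. const2 (c L b) * T L b x y)"
proof -
  have "const2 c * A = diag (\<lambda>n m. c) A" for c A by (rule series2_eqI) simp
  then show ?thesis using admissible_diag[OF multiplier_const[OF assms(1)] assms(2)] by simp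
qed

lemma admissible_diff:
  assumes "admissible j S" "admissible j T"
  shows "admissible j (\<lambda>L b x y. S L b x y - T L b x y)"
  using admissible_add[OF assms(1) admissible_scale[OF rational_const[of "-1"] assms(2)]]
  by (simp add: const2_hom)

definition shift :: "complex \<Rightarrow> (nat \<Rightarrow> complex) \<Rightarrow> complex fps fps \<Rightarrow> complex fps fps" where
  "shift L b A = diag (\<lambda>n m. shift_factor n m L b) A"

lemma admissible_shift: "admissible j T \<Longrightarrow> admissible j (\<lambda>L b x y. shift L b (T L b x y))"
  unfolding shift_def by (rule admissible_diag[OF multiplier_shift_factor])

text \<open>\<open>l\<close> is the linear part of \<open>P\<close> at one, up to level 2. It
  behaves like a logarithmic derivative: products of such operators have the sum of the linear
  parts.\<close>

definition near_one :: "operator2 \<Rightarrow> operator2 \<Rightarrow> bool" where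
  "near_one P l \<longleftrightarrow> admissible 1 l \<and> admissible 2 (\<lambda>L b x y. P L b x y - 1 - l L b x y)"

lemma near_one_minus_one: "near_one P l \<Longrightarrow> admissible 1 (\<lambda>L b x y. P L b x y - 1)"
  using admissible_add[OF admissible_weaken, of "\<lambda>L b x y. P L b x y - 1 - l L b x y" l]
  by (simp add: near_one_def)

lemma near_one_one_plus: "admissible 1 l \<Longrightarrow> near_one (\<lambda>L b x y. 1 + l L b x y) l"
  using admissible_zero by (simp add: near_one_def)

lemma near_one_one: "near_one (\<lambda>L b x y. 1) (\<lambda>L b x y. 0)"
  using admissible_zero admissible_weaken[OF admissible_zero] by (simp add: near_one_def)

lemma near_one_perturb:
  assumes "near_one P l" "admissible 2 w"
  shows "near_one (\<lambda>L b x y. P L b x y - w L b x y) l"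
  using assms admissible_diff[OF _ assms(2), of "\<lambda>L b x y. P L b x y - 1 - l L b x y"]
  by (simp add: near_one_def algebra_simps)

lemma near_one_mult:
  assumes P: "near_one P l" and Q: "near_one Q k"
  shows "near_one (\<lambda>L b x y. P L b x y * Q L b x y) (\<lambda>L b x y. l L b x y + k L b x y)"
proof -
  have "admissible 2 (\<lambda>L b x y. (P L b x y - 1 - l L b x y) + (Q L b x y - 1 - k L b x y)
      + (P L b x y - 1) * (Q L b x y - 1))"
    using P Q near_one_minus_one[OF P] near_one_minus_one[OF Q]
    by (intro admissible_add admissible_mult) (auto simp: near_one_def)
  moreover have "(P L b x y - 1 - l L b x y) + (Q L b x y - 1 - k L b x y)
      + (P L b x y - 1) * (Q L b x y - 1) = P L b x y * Q L b x y - 1 - (l L b x y + k L b x y)" for L b x y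
    by (simp add: algebra_simps)
  ultimately have "admissible 2 (\<lambda>L b x y. P L b x y * Q L b x y - 1 - (l L b x y + k L b x y))"
    by (simp only:)
  then show ?thesis
    using P Q by (auto simp: near_one_def intro: admissible_add)
qed

text \<open>Needed for terms such as \<open>Z1 * (1 + y)\<close>: the constant 1 is not admissible,
  but \<open>T * P = T + T * (P - 1)\<close> is a sum of admissible terms.\<close>

lemma admissible_mult_near_one:
  assumes "admissible 2 T" "near_one P l"
  shows "admissible 2 (\<lambda>L b x y. T L b x y * P L b x y)"
proof -
  have "admissible 2 (\<lambda>L b x y. T L b x y + T L b x y * (P L b x y - 1))"
    by (intro admissible_add admissible_mult assms(1) admissible_weaken[OF assms(1)]
        near_one_minus_one[OF assms(2)])
  then show ?thesis by (simp add: algebra_simps)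
qed

subsection \<open>The normalised equations\<close>

text \<open>The sides of the two equations for \<open>f = Z1 * (1 + x)\<close> and \<open>g = L * Z1 * (1 + y)\<close>, after
  dividing each factor by its leading term. The products of the leading terms agree on both sides.\<close>

definition lhs1 :: operator2 where
  "lhs1 L b x y =
     ((1 + x) * (1 + y) - const2 (inverse L) * (Z2 * Z2)) *
     (((1 + shift L b x) * (1 + y) - const2 (q2 L b * inverse L) * (Z2 * Z2)) *
     ((1 - const2 (L * inverse (b 5)) * (Z1 * (1 + y))) *
     ((1 - const2 (L * inverse (b 6)) * (Z1 * (1 + y))) *
     ((1 - const2 (L * inverse (b 7)) * (Z1 * (1 + y))) *
      (1 - const2 (L * inverse (b 8)) * (Z1 * (1 + y)))))))"

definition rhs1 :: operator2 where
  "rhs1 L b x y =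
     (1 - const2 L * ((Z1 * Z1) * ((1 + x) * (1 + y)))) *
     ((1 - const2 (q1 L b * L) * ((Z1 * Z1) * ((1 + shift L b x) * (1 + y)))) *
     (((1 + y) - const2 (b 1 * inverse L) * Z2) *
     (((1 + y) - const2 (b 2 * inverse L) * Z2) *
     (((1 + y) - const2 (b 3 * inverse L) * Z2) *
      ((1 + y) - const2 (b 4 * inverse L) * Z2)))))"

definition lhs2 :: operator2 where
  "lhs2 L b x y =
     ((1 + shift L b x) * (1 + y) - const2 (q2 L b * inverse L) * (Z2 * Z2)) *
     (((1 + shift L b x) * (1 + shift L b y) - const2 (q2 L b * q2 L b * inverse L) * (Z2 * Z2)) *
     ((1 - const2 (q1 L b * b 5) * (Z1 * (1 + shift L b x))) *
     ((1 - const2 (q1 L b * b 6) * (Z1 * (1 + shift L b x))) *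
     ((1 - const2 (q1 L b * b 7) * (Z1 * (1 + shift L b x))) *
      (1 - const2 (q1 L b * b 8) * (Z1 * (1 + shift L b x)))))))"

definition rhs2 :: operator2 where
  "rhs2 L b x y =
     (1 - const2 (q1 L b * L) * ((Z1 * Z1) * ((1 + shift L b x) * (1 + y)))) *
     ((1 - const2 (q1 L b * q1 L b * L) * ((Z1 * Z1) * ((1 + shift L b x) * (1 + shift L b y)))) *
     (((1 + shift L b x) - const2 (q2 L b * inverse (b 1)) * Z2) *
     (((1 + shift L b x) - const2 (q2 L b * inverse (b 2)) * Z2) *
     (((1 + shift L b x) - const2 (q2 L b * inverse (b 3)) * Z2) *
      ((1 + shift L b x) - const2 (q2 L b * inverse (b 4)) * Z2)))))"

lemma rational_inverse_Lam: "rational (\<lambda>L b. inverse L)"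
  using qPA1_goodD by (intro rational_inverse rational_Lam) blast

lemma rational_inverse_b: "k \<in> {1..8} \<Longrightarrow> rational (\<lambda>L b. inverse (b k))"
  by (intro rational_inverse rational_b) (auto dest!: qPA1_goodD simp: qPA1_B_def)

lemmas admissible_Z1Z1 =
  admissible_mult[OF admissible_weaken[OF admissible_Z1] admissible_weaken[OF admissible_Z1]]
lemmas admissible_Z2Z2 =
  admissible_mult[OF admissible_weaken[OF admissible_Z2] admissible_weaken[OF admissible_Z2]]

text \<open>Every factor of the normalised equations is 1, or a product of terms
  \<open>1 + x\<close>, \<open>1 + y\<close> and their shifts, minus a multiple of a term of level
  2. These rules therefore follow the syntax of each side.\<close>

lemmas near_one_intros =
  near_one_mult near_one_perturb near_one_one near_one_one_plus
  admissible_scale admissible_mult_near_one[OF admissible_Z1]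
  admissible_mult_near_one[OF admissible_Z1Z1] admissible_Z2 admissible_Z2Z2
  admissible_shift admissible_fst admissible_snd
  rational_mult rational_inverse_Lam rational_inverse_b rational_q1 rational_q2 rational_Lam rational_b

text \<open>With \<open>s\<close> for the shift, the subtracted linear part is
  \<open>(x + y) + (s x + y)\<close> from the left minus \<open>4 y\<close> from the right. For the
  second equation it is \<open>(s x + y) + (s x + s y)\<close> minus \<open>4 s x\<close>.\<close>

definition rest1 :: operator2 where
  "rest1 L b x y = lhs1 L b x y - rhs1 L b x y - (x + shift L b x - (y + y))"

definition rest2 :: operator2 where
  "rest2 L b x y = lhs2 L b x y - rhs2 L b x y - (y + shift L b y - (shift L b x + shift L b x))"

lemma near_one_diff:
  assumes "near_one P l" "near_one Q k"
    and "\<And>L b x y. l L b x y - k L b x y = h L b x y"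
  shows "admissible 2 (\<lambda>L b x y. P L b x y - Q L b x y - h L b x y)"
proof -
  have "admissible 2 (\<lambda>L b x y. (P L b x y - 1 - l L b x y) - (Q L b x y - 1 - k L b x y))"
    using assms(1,2) unfolding near_one_def by (intro admissible_diff[OF conjunct2 conjunct2])
  then show ?thesis by (simp add: algebra_simps flip: assms(3))
qed

lemma admissible_rest1: "admissible 2 rest1"
  unfolding rest1_def[abs_def] lhs1_def rhs1_def
proof (rule near_one_diff)
  \<comment> \<open>Each 0 in the linear part comes from a factor that differs from 1 only at level
    2.\<close>
  show "near_one (\<lambda>L b x y.
     ((1 + x) * (1 + y) - const2 (inverse L) * (Z2 * Z2)) *
     (((1 + shift L b x) * (1 + y) - const2 (q2 L b * inverse L) * (Z2 * Z2)) *
     ((1 - const2 (L * inverse (b 5)) * (Z1 * (1 + y))) *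
     ((1 - const2 (L * inverse (b 6)) * (Z1 * (1 + y))) *
     ((1 - const2 (L * inverse (b 7)) * (Z1 * (1 + y))) *
      (1 - const2 (L * inverse (b 8)) * (Z1 * (1 + y)))))))) 
   (\<lambda>L b x y. (x + y) + ((shift L b x + y) + (0 + (0 + (0 + 0)))))"
    by (rule near_one_intros | simp)+
  show "near_one (\<lambda>L b x y.
     (1 - const2 L * ((Z1 * Z1) * ((1 + x) * (1 + y)))) *
     ((1 - const2 (q1 L b * L) * ((Z1 * Z1) * ((1 + shift L b x) * (1 + y)))) *
     (((1 + y) - const2 (b 1 * inverse L) * Z2) *
     (((1 + y) - const2 (b 2 * inverse L) * Z2) *
     (((1 + y) - const2 (b 3 * inverse L) * Z2) *
      ((1 + y) - const2 (b 4 * inverse L) * Z2))))))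
   (\<lambda>L b x y. 0 + (0 + (y + (y + (y + y)))))"
    by (rule near_one_intros | simp)+
qed simp

lemma admissible_rest2: "admissible 2 rest2"
  unfolding rest2_def[abs_def] lhs2_def rhs2_def
proof (rule near_one_diff)
  show "near_one (\<lambda>L b x y.
     ((1 + shift L b x) * (1 + y) - const2 (q2 L b * inverse L) * (Z2 * Z2)) *
     (((1 + shift L b x) * (1 + shift L b y) - const2 (q2 L b * q2 L b * inverse L) * (Z2 * Z2)) *
     ((1 - const2 (q1 L b * b 5) * (Z1 * (1 + shift L b x))) *
     ((1 - const2 (q1 L b * b 6) * (Z1 * (1 + shift L b x))) *
     ((1 - const2 (q1 L b * b 7) * (Z1 * (1 + shift L b x))) *
      (1 - const2 (q1 L b * b 8) * (Z1 * (1 + shift L b x))))))))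
   (\<lambda>L b x y. (shift L b x + y) + ((shift L b x + shift L b y) + (0 + (0 + (0 + 0)))))"
    by (rule near_one_intros | simp)+
  show "near_one (\<lambda>L b x y.
     (1 - const2 (q1 L b * L) * ((Z1 * Z1) * ((1 + shift L b x) * (1 + y)))) *
     ((1 - const2 (q1 L b * q1 L b * L) * ((Z1 * Z1) * ((1 + shift L b x) * (1 + shift L b y)))) *
     (((1 + shift L b x) - const2 (q2 L b * inverse (b 1)) * Z2) *
     (((1 + shift L b x) - const2 (q2 L b * inverse (b 2)) * Z2) *
     (((1 + shift L b x) - const2 (q2 L b * inverse (b 3)) * Z2) *
      ((1 + shift L b x) - const2 (q2 L b * inverse (b 4)) * Z2))))))
   (\<lambda>L b x y. 0 + (0 + (shift L b x + (shift L b x + (shift L b x + shift L b x)))))"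
    by (rule near_one_intros | simp)+
qed simp

subsection \<open>Solving the linear part\<close>

text \<open>On the coefficients of \<open>z1 ^ n * z2 ^ m\<close> the linear part is the matrix with rows \<open>(1 + s, -2)\<close> and
  \<open>(-2 * s, 1 + s)\<close>, of determinant \<open>(1 - s) ^ 2\<close>, where \<open>s = q1 ^ n * q2 ^ m\<close>. The multipliers
  below are the entries of minus its inverse, set to \<open>0\<close> for \<open>n = m = 0\<close>.\<close>

definition mult_diag :: "nat \<Rightarrow> nat \<Rightarrow> complex \<Rightarrow> (nat \<Rightarrow> complex) \<Rightarrow> complex" where
  "mult_diag n m L b = (-1) * ((1 + shift_factor n m L b) * (resolvent n m L b * resolvent n m L b))"

definition mult_up :: "nat \<Rightarrow> nat \<Rightarrow> complex \<Rightarrow> (nat \<Rightarrow> complex) \<Rightarrow> complex" where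
  "mult_up n m L b = (-2) * (resolvent n m L b * resolvent n m L b)"

definition mult_low :: "nat \<Rightarrow> nat \<Rightarrow> complex \<Rightarrow> (nat \<Rightarrow> complex) \<Rightarrow> complex" where
  "mult_low n m L b = (-2) * (shift_factor n m L b * (resolvent n m L b * resolvent n m L b))"

lemma multiplier_inverse_matrix: "multiplier mult_diag" "multiplier mult_up" "multiplier mult_low"
  unfolding mult_diag_def[abs_def] mult_up_def[abs_def] mult_low_def[abs_def]
  by (intro multiplier_mult multiplier_add multiplier_const multiplier_shift_factor
      multiplier_resolvent rational_const)+

definition step1 :: operator2 where
  "step1 L b x y = diag (\<lambda>n m. mult_diag n m L b) (rest1 L b x y) + diag (\<lambda>n m. mult_up n m L b) (rest2 L b x y)"

definition step2 :: operator2 where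
  "step2 L b x y = diag (\<lambda>n m. mult_low n m L b) (rest1 L b x y) + diag (\<lambda>n m. mult_diag n m L b) (rest2 L b x y)"

interpretation qPA1: contraction_pair step1 step2
proof
  show "admissible 2 step1" "admissible 2 step2"
    unfolding step1_def[abs_def] step2_def[abs_def]
    by (intro admissible_add admissible_diag multiplier_inverse_matrix admissible_rest1 admissible_rest2)+
qed

text \<open>The adjugate of the matrix has rows \<open>(1 + s, 2)\<close> and
  \<open>(2 * s, 1 + s)\<close>, and \<rho> squared is the inverse of the determinant; the sign
  comes from moving \<open>w1\<close> and \<open>w2\<close> to the other side.\<close>

lemma linear_system_2:
  fixes s \<rho> x y w1 w2 :: complex
  assumes "(1 - s) * \<rho> = 1"
  shows "x + s * x - (y + y) + w1 = 0 \<and> y + s * y - (s * x + s * x) + w2 = 0 \<longleftrightarrow>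
    x = (-1) * ((1 + s) * (\<rho> * \<rho>)) * w1 + (-2) * (\<rho> * \<rho>) * w2 \<and>
    y = (-2) * (s * (\<rho> * \<rho>)) * w1 + (-1) * ((1 + s) * (\<rho> * \<rho>)) * w2" (is "?A \<longleftrightarrow> ?B")
proof
  assume ?A
  then have w: "w1 = (y + y) - x - s * x" "w2 = (s * x + s * x) - y - s * y"
    by (auto simp: algebra_simps eq_neg_iff_add_eq_0)
  have "(-1) * ((1 + s) * (\<rho> * \<rho>)) * w1 + (-2) * (\<rho> * \<rho>) * w2 = ((1 - s) * \<rho>) * ((1 - s) * \<rho>) * x"
    "(-2) * (s * (\<rho> * \<rho>)) * w1 + (-1) * ((1 + s) * (\<rho> * \<rho>)) * w2 = ((1 - s) * \<rho>) * ((1 - s) * \<rho>) * y"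
    unfolding w by (simp_all add: algebra_simps)
  then show ?B using assms by simp
next
  assume B: ?B
  have "x + s * x - (y + y) + w1 = (1 - ((1 - s) * \<rho>) * ((1 - s) * \<rho>)) * w1"
    "y + s * y - (s * x + s * x) + w2 = (1 - ((1 - s) * \<rho>) * ((1 - s) * \<rho>)) * w2"
    unfolding conjunct1[OF B] conjunct2[OF B] by (simp_all add: algebra_simps)
  then show ?A using assms by simp
qed

lemma normalised_iff_fixed_point:
  assumes good: "(L, b) \<in> qPA1_good" and xy: "x \<in> order_ge 1" "y \<in> order_ge 1"
  shows "lhs1 L b x y = rhs1 L b x y \<and> lhs2 L b x y = rhs2 L b x y \<longleftrightarrow>
    x = step1 L b x y \<and> y = step2 L b x y"
proof -
  define w1 where "w1 = rest1 L b x y"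
  define w2 where "w2 = rest2 L b x y"
  have w: "w1 \<in> order_ge 1" "w2 \<in> order_ge 1"
    unfolding w1_def w2_def
    by (rule admissible_order_ge_1[OF admissible_rest1 xy] admissible_order_ge_1[OF admissible_rest2 xy])+
  define E1 where "E1 n m = coeff2 (x + shift L b x - (y + y) + w1) n m" for n m
  define E2 where "E2 n m = coeff2 (y + shift L b y - (shift L b x + shift L b x) + w2) n m" for n m
  have "lhs1 L b x y = rhs1 L b x y \<longleftrightarrow> x + shift L b x - (y + y) + w1 = 0"
    by (simp add: w1_def rest1_def)
  also have "\<dots> \<longleftrightarrow> (\<forall>n m. E1 n m = 0)"
    unfolding E1_def by (metis series2_eqI coeff2_simps(1))
  finally have 1: "lhs1 L b x y = rhs1 L b x y \<longleftrightarrow> (\<forall>n m. E1 n m = 0)" .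
  have "lhs2 L b x y = rhs2 L b x y \<longleftrightarrow> y + shift L b y - (shift L b x + shift L b x) + w2 = 0"
    by (simp add: w2_def rest2_def)
  also have "\<dots> \<longleftrightarrow> (\<forall>n m. E2 n m = 0)"
    unfolding E2_def by (metis series2_eqI coeff2_simps(1))
  finally have 2: "lhs2 L b x y = rhs2 L b x y \<longleftrightarrow> (\<forall>n m. E2 n m = 0)" .
  have "E1 n m = 0 \<and> E2 n m = 0 \<longleftrightarrow>
      coeff2 x n m = coeff2 (step1 L b x y) n m \<and> coeff2 y n m = coeff2 (step2 L b x y) n m" for n m
  proof (cases "(n, m) = (0, 0)")
    \<comment> \<open>The matrix is singular here, but all constant terms vanish, so both sides of
      the equivalence hold trivially.\<close>
    case True
    then show ?thesis
      using order_geD[OF xy(1), of 0 0] order_geD[OF xy(2), of 0 0]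
        order_geD[OF w(1), of 0 0] order_geD[OF w(2), of 0 0]
      by (simp add: E1_def E2_def shift_def step1_def step2_def w1_def w2_def)
  next
    case False
    have "(1 - shift_factor n m L b) * resolvent n m L b = 1"
      using shift_factor_neq_1[OF good False] False by (auto simp: resolvent_def)
    from linear_system_2[OF this, of "coeff2 x n m" "coeff2 y n m" "coeff2 w1 n m" "coeff2 w2 n m"]
    show ?thesis
      by (simp only: coeff2_simps E1_def E2_def shift_def step1_def step2_def w1_def[symmetric] w2_def[symmetric]
          mult_diag_def mult_up_def mult_low_def)
  qed
  then show ?thesis unfolding 1 2 by (metis series2_eqI)
qed

subsection \<open>From triangular arrays to power series in two variables\<close>

text \<open>With \<open>z1 = t * phi\<close> and \<open>z2 = 1 / phi\<close> the monomial \<open>phi ^ i * t ^ n\<close> becomes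
  \<open>z1 ^ n * z2 ^ (n - i)\<close>.\<close>

definition to_series :: "tps \<Rightarrow> complex fps fps" where
  "to_series A = series2 (\<lambda>n m. A n (int n - int m))"

lemma coeff2_to_series [simp]: "coeff2 (to_series A) n m = A n (int n - int m)"
  by (simp add: to_series_def)

lemma to_series_mult: "to_series (tp_mult A B) = to_series A * to_series B"
proof (rule series2_eqI)
  fix n m
  have "coeff2 (to_series (tp_mult A B)) n m =
      (\<Sum>a = 0..n. \<Sum>i\<in>{int n - int m - int (n - a)..int a}. A a i * B (n - a) (int n - int m - i))"
    by (simp add: tp_mult_def)
  also have "\<dots> = (\<Sum>a = 0..n. \<Sum>j = 0..m. A a (int a - int j) * B (n - a) (int (n - a) - int (m - j)))"
  proof (intro sum.cong refl)
    fix a assume "a \<in> {0..n}"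
    then have a: "int (n - a) = int n - int a" by auto
    show "(\<Sum>i\<in>{int n - int m - int (n - a)..int a}. A a i * B (n - a) (int n - int m - i)) =
        (\<Sum>j = 0..m. A a (int a - int j) * B (n - a) (int (n - a) - int (m - j)))"
      \<comment> \<open>The lower limit equals \<open>a - m\<close>, so \<open>j = a - i\<close>
        runs exactly through \<open>0..m\<close>.\<close>
      by (rule sum.reindex_bij_witness[where i = "\<lambda>j. int a - int j" and j = "\<lambda>i. nat (int a - i)"])
         (auto simp: a algebra_simps)
  qed
  also have "\<dots> = coeff2 (to_series A * to_series B) n m"
    by (simp add: coeff2_mult)
  finally show "coeff2 (to_series (tp_mult A B)) n m = coeff2 (to_series A * to_series B) n m" .
qed

lemma to_series_diff: "to_series (tp_diff A B) = to_series A - to_series B"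
  by (rule series2_eqI) (simp add: tp_diff_def)

text \<open>\<open>Z1 * Z2\<close> stands for \<open>t\<close>, whose powers sit on the diagonal,
  where \<open>phi\<close> has exponent 0.\<close>

lemma coeff2_t_power: "coeff2 ((Z1 * Z2) ^ j) n m = (if n = j \<and> m = j then 1 else 0)"
  by (induction j arbitrary: n m) (auto simp: mult.assoc)

lemma to_series_mon: "to_series (tp_mon j c) = const2 c * (Z1 * Z2) ^ j"
  by (rule series2_eqI) (auto simp: tp_mon_def coeff2_t_power)

lemma to_series_prod: "to_series (tp_prod As) = prod_list (map to_series As)"
  by (induction As) (auto simp: tp_prod_def to_series_mult to_series_mon const2_hom)

text \<open>The factor of \<open>t ^ n * phi ^ (n - m)\<close> is
  \<open>q ^ n * lam ^ (n - m)\<close>, that is, \<open>(q * lam) ^ n\<close> times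
  \<open>lam ^ (- m)\<close>; splitting the integer power requires \<open>lam\<close> to be
  nonzero.\<close>

lemma to_series_shift:
  assumes "qPA1_lambda L b \<noteq> 0"
  shows "to_series (tp_shift (qPA1_q b) (qPA1_lambda L b) A) = shift L b (to_series A)"
  by (rule series2_eqI)
     (use assms in \<open>simp add: shift_def tp_shift_def shift_factor_def q1_def q2_def
        power_int_diff field_simps\<close>)

text \<open>\<open>to_series\<close> does not see the entries with \<open>i > n\<close>, so these
  are fixed by the hypotheses.\<close>

lemma to_series_eq_iff:
  assumes "\<And>n i. int n < i \<Longrightarrow> A n i = 0" "\<And>n i. int n < i \<Longrightarrow> B n i = 0"
  shows "A = B \<longleftrightarrow> to_series A = to_series B"
proof
  assume eq: "to_series A = to_series B"
  show "A = B"
  proof (intro ext)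
    fix n i
    show "A n i = B n i"
    proof (cases "int n < i")
      case False
      then have "int n - int (nat (int n - i)) = i" by simp
      then show ?thesis
        using arg_cong[OF eq, of "\<lambda>S. coeff2 S n (nat (int n - i))"] by simp
    qed (use assms in simp)
  qed
qed simp

text \<open>For \<open>i > n\<close> the inner summation range in \<open>tp_mult\<close> is empty,
  whatever the factors are.\<close>

lemma tp_prod_triangular:
  assumes "As \<noteq> []" "int n < i"
  shows "tp_prod As n i = 0"
  using assms by (cases As) (auto simp: tp_prod_def tp_mult_def)

lemma tp_prod_eq_iff:
  assumes "As \<noteq> []" "Bs \<noteq> []"
  shows "tp_prod As = tp_prod Bs \<longleftrightarrow> prod_list (map to_series As) = prod_list (map to_series Bs)"
  using to_series_eq_iff[of "tp_prod As" "tp_prod Bs"] tp_prod_triangular[OF assms(1)]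
    tp_prod_triangular[OF assms(2)] by (simp add: to_series_prod)

subsection \<open>Equivalence with the normalised equations\<close>

lemma shift_one_plus: "shift L b (1 + x) = 1 + shift L b x"
  by (rule series2_eqI) (auto simp: shift_def shift_factor_def algebra_simps)

lemma shift_Z1_mult: "shift L b (Z1 * A) = const2 (q1 L b) * (Z1 * shift L b A)"
proof (rule series2_eqI)
  fix n m
  show "coeff2 (shift L b (Z1 * A)) n m = coeff2 (const2 (q1 L b) * (Z1 * shift L b A)) n m"
    by (cases n) (auto simp: shift_def shift_factor_def)
qed

lemma shift_const2_mult: "shift L b (const2 c * A) = const2 c * shift L b A"
  by (simp add: shift_def diag_const2_mult)

lemma qPA1_eq_iff:
  fixes f g :: tps
  assumes good: "(L, b) \<in> qPA1_good"
    and f: "to_series f = Z1 * (1 + x)" and g: "to_series g = Z1 * (const2 L * (1 + y))"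
  shows "qPA1_eq1 L b f g \<longleftrightarrow> lhs1 L b x y = rhs1 L b x y"
    and "qPA1_eq2 L b f g \<longleftrightarrow> lhs2 L b x y = rhs2 L b x y"
proof -
  define q where "q = qPA1_q b"
  define X where "X = 1 + shift L b x"
  define Y where "Y = 1 + shift L b y"
  have L: "L \<noteq> 0" and b: "b 1 \<noteq> 0" "b 2 \<noteq> 0" "b 3 \<noteq> 0" "b 4 \<noteq> 0" "b 5 \<noteq> 0" "b 6 \<noteq> 0" "b 7 \<noteq> 0" "b 8 \<noteq> 0"
    using qPA1_goodD[OF good] qPA1_B_nz by auto
  have lam: "qPA1_lambda L b \<noteq> 0" using L b by (simp add: qPA1_lambda_def)
  \<comment> \<open>The balance of the leading coefficients; it makes the prefactors below agree in
    both equations.\<close>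
  have q1: "q1 L b * (b 5 * b 6 * b 7 * b 8) = L ^ 2"
    using qPA1_goodD[OF good] b by (simp add: q1_eq)
  have q: "q = q1 L b * q2 L b" using lam by (simp add: q_def q1_def q2_def)
  have fs: "to_series (tp_shift q (qPA1_lambda L b) f) = const2 (q1 L b) * (Z1 * X)"
    by (simp add: q_def to_series_shift[OF lam] f shift_Z1_mult shift_one_plus X_def)
  have gs: "to_series (tp_shift q (qPA1_lambda L b) g) = const2 (q1 L b) * (Z1 * (const2 L * Y))"
    by (simp add: q_def to_series_shift[OF lam] g shift_Z1_mult shift_const2_mult shift_one_plus Y_def)
  have Z1_nz: "Z1 \<noteq> 0" by (simp add: Z1_def)
  have c0: "const2 c \<noteq> 0" if "c \<noteq> 0" for c using that const2_inject[of c 0] by (simp add: const2_hom)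

  \<comment> \<open>This identity and the following ones pull the leading term out of each kind of
    factor, leaving the normalised factor, which has constant term 1.\<close>
  have gf: "Z1 * (const2 L * (1 + y)) * (Z1 * (1 + x)) - const2 1 * (Z1 * Z2) ^ 2 =
      const2 L * (Z1 * Z1) * ((1 + x) * (1 + y) - const2 (inverse L) * (Z2 * Z2))"
  proof -
    have "const2 1 = const2 L * const2 (inverse L)" using L by (simp add: field_simps flip: const2_hom(5))
    then show ?thesis by (simp only:) (simp add: power2_eq_square algebra_simps)
  qed
  have gfs: "Z1 * (const2 L * (1 + y)) * (const2 (q1 L b) * (Z1 * X)) - const2 q * (Z1 * Z2) ^ 2 =
      const2 (q1 L b * L) * (Z1 * Z1) * (X * (1 + y) - const2 (q2 L b * inverse L) * (Z2 * Z2))"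
  proof -
    have "const2 q = const2 (q1 L b * L) * const2 (q2 L b * inverse L)"
      using L by (simp add: q field_simps flip: const2_hom(5))
    then show ?thesis by (simp only: const2_hom(5)) (simp add: power2_eq_square algebra_simps)
  qed
  have gsfs: "const2 (q1 L b) * (Z1 * (const2 L * Y)) * (const2 (q1 L b) * (Z1 * X)) - const2 (q ^ 2) * (Z1 * Z2) ^ 2 =
      const2 (q1 L b * q1 L b * L) * (Z1 * Z1) * (X * Y - const2 (q2 L b * q2 L b * inverse L) * (Z2 * Z2))"
  proof -
    have "const2 (q ^ 2) = const2 (q1 L b * q1 L b * L) * const2 (q2 L b * q2 L b * inverse L)"
      using L by (simp add: q power2_eq_square field_simps flip: const2_hom(5))
    then show ?thesis by (simp only: const2_hom(5)) (simp add: power2_eq_square algebra_simps)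
  qed
  have gb: "Z1 * (const2 L * (1 + y)) - const2 c * (Z1 * Z2) ^ 0 =
      const2 (- c) * (1 - const2 (L * inverse c) * (Z1 * (1 + y)))" if "c \<noteq> 0" for c
  proof -
    have "const2 L = const2 c * const2 (L * inverse c)" using that by (simp add: field_simps flip: const2_hom(5))
    then show ?thesis by (simp only: const2_hom(6)) (simp add: algebra_simps)
  qed
  have gbt: "Z1 * (const2 L * (1 + y)) - const2 c * (Z1 * Z2) ^ 1 =
      const2 L * Z1 * ((1 + y) - const2 (c * inverse L) * Z2)" for c
  proof -
    have "const2 c = const2 L * const2 (c * inverse L)" using L by (simp add: field_simps flip: const2_hom(5))
    then show ?thesis by (simp only:) (simp add: algebra_simps)
  qed
  have fb: "const2 (q1 L b) * (Z1 * X) - const2 (inverse c) * (Z1 * Z2) ^ 0 =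
      const2 (- inverse c) * (1 - const2 (q1 L b * c) * (Z1 * X))" if "c \<noteq> 0" for c
  proof -
    have "const2 (q1 L b) = const2 (inverse c) * const2 (q1 L b * c)"
      using that by (simp add: field_simps flip: const2_hom(5))
    then show ?thesis by (simp only: const2_hom(6)) (simp add: algebra_simps)
  qed
  have fbt: "const2 (q1 L b) * (Z1 * X) - const2 (inverse c * q) * (Z1 * Z2) ^ 1 =
      const2 (q1 L b) * Z1 * (X - const2 (q2 L b * inverse c) * Z2)" for c
  proof -
    have "const2 (inverse c * q) = const2 (q1 L b) * const2 (q2 L b * inverse c)"
      by (simp add: q mult_ac flip: const2_hom(5))
    then show ?thesis by (simp only:) (simp add: algebra_simps)
  qed
  have gf1: "Z1 * (const2 L * (1 + y)) * (Z1 * (1 + x)) - const2 1 * (Z1 * Z2) ^ 0 =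
      const2 (-1) * (1 - const2 L * ((Z1 * Z1) * ((1 + x) * (1 + y))))"
    by (simp add: const2_hom algebra_simps)
  have gfs1: "Z1 * (const2 L * (1 + y)) * (const2 (q1 L b) * (Z1 * X)) - const2 1 * (Z1 * Z2) ^ 0 =
      const2 (-1) * (1 - const2 (q1 L b * L) * ((Z1 * Z1) * (X * (1 + y))))"
    by (simp add: const2_hom algebra_simps)
  have gsfs1: "const2 (q1 L b) * (Z1 * (const2 L * Y)) * (const2 (q1 L b) * (Z1 * X)) - const2 1 * (Z1 * Z2) ^ 0 =
      const2 (-1) * (1 - const2 (q1 L b * q1 L b * L) * ((Z1 * Z1) * (X * Y)))"
    by (simp add: const2_hom algebra_simps)

  \<comment> \<open>Each side is a prefactor times its normalised form. Both prefactors turn out to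
    be the same nonzero constant times \<open>z1 ^ 4\<close>, which cancels.\<close>
  have "qPA1_eq1 L b f g \<longleftrightarrow>
     (const2 L * (Z1 * Z1) * (const2 (q1 L b * L) * (Z1 * Z1)) *
       (const2 (- b 5) * const2 (- b 6) * (const2 (- b 7) * const2 (- b 8)))) * lhs1 L b x y =
     (const2 (-1) * const2 (-1) * (const2 L * Z1 * (const2 L * Z1) * (const2 L * Z1 * (const2 L * Z1)))) *
       rhs1 L b x y"
    unfolding qPA1_eq1_def Let_def
    by (subst tp_prod_eq_iff)
       (simp_all only: list.simps prod_list.Cons prod_list.Nil simp_thms
         to_series_diff to_series_mult to_series_mon f g fs q_def[symmetric] gf gfs gb b gbt gf1 gfs1
         lhs1_def rhs1_def X_def[symmetric] mult_1_right, simp_all only: mult_ac)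
  also have "const2 L * (Z1 * Z1) * (const2 (q1 L b * L) * (Z1 * Z1)) *
       (const2 (- b 5) * const2 (- b 6) * (const2 (- b 7) * const2 (- b 8))) =
       const2 (L ^ 4) * (Z1 * Z1 * (Z1 * Z1))"
  proof -
    have "const2 (L ^ 4) = const2 L * const2 (q1 L b * L) * (const2 (- b 5) * const2 (- b 6) * (const2 (- b 7) * const2 (- b 8)))"
      using q1 by (simp add: power2_eq_square power4_eq_xxxx algebra_simps flip: const2_hom(5))
    then show ?thesis by (simp only: mult_ac)
  qed
  also have "const2 (-1) * const2 (-1) * (const2 L * Z1 * (const2 L * Z1) * (const2 L * Z1 * (const2 L * Z1))) =
       const2 (L ^ 4) * (Z1 * Z1 * (Z1 * Z1))"
    by (simp add: const2_hom power4_eq_xxxx mult_ac)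
  finally show "qPA1_eq1 L b f g \<longleftrightarrow> lhs1 L b x y = rhs1 L b x y"
    using Z1_nz c0[of "L ^ 4"] L by simp

  have "qPA1_eq2 L b f g \<longleftrightarrow>
     (const2 (q1 L b * L) * (Z1 * Z1) * (const2 (q1 L b * q1 L b * L) * (Z1 * Z1)) *
       (const2 (- inverse (b 5)) * const2 (- inverse (b 6)) * (const2 (- inverse (b 7)) * const2 (- inverse (b 8))))) * lhs2 L b x y =
     (const2 (-1) * const2 (-1) * (const2 (q1 L b) * Z1 * (const2 (q1 L b) * Z1) * (const2 (q1 L b) * Z1 * (const2 (q1 L b) * Z1)))) *
       rhs2 L b x y"
    unfolding qPA1_eq2_def Let_def
    by (subst tp_prod_eq_iff)
       (simp_all only: list.simps prod_list.Cons prod_list.Nil simp_thms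
         to_series_diff to_series_mult to_series_mon f g fs gs q_def[symmetric] gfs gsfs fb b fbt gfs1 gsfs1
         lhs2_def rhs2_def X_def[symmetric] Y_def[symmetric] mult_1_right, simp_all only: mult_ac)
  also have "const2 (q1 L b * L) * (Z1 * Z1) * (const2 (q1 L b * q1 L b * L) * (Z1 * Z1)) *
       (const2 (- inverse (b 5)) * const2 (- inverse (b 6)) * (const2 (- inverse (b 7)) * const2 (- inverse (b 8)))) =
       const2 (q1 L b ^ 4) * (Z1 * Z1 * (Z1 * Z1))"
  proof -
    have "q1 L b ^ 4 = q1 L b * L * (q1 L b * q1 L b * L) * ((- inverse (b 5)) * (- inverse (b 6)) * ((- inverse (b 7)) * (- inverse (b 8))))"
    proof -
      have "q1 L b * L * (q1 L b * q1 L b * L) * ((- inverse (b 5)) * (- inverse (b 6)) * ((- inverse (b 7)) * (- inverse (b 8)))) =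
        q1 L b ^ 3 * (L ^ 2) / (b 5 * b 6 * b 7 * b 8)"
        using b by (simp add: field_simps power2_eq_square power3_eq_cube)
      also have "\<dots> = q1 L b ^ 4" unfolding q1[symmetric] using b by (simp add: power4_eq_xxxx power3_eq_cube)
      finally show ?thesis by simp
    qed
    then have "const2 (q1 L b ^ 4) = const2 (q1 L b * L) * const2 (q1 L b * q1 L b * L) *
      (const2 (- inverse (b 5)) * const2 (- inverse (b 6)) * (const2 (- inverse (b 7)) * const2 (- inverse (b 8))))"
      by (simp only: flip: const2_hom(5))
    then show ?thesis by (simp only: mult_ac)
  qed
  also have "const2 (-1) * const2 (-1) * (const2 (q1 L b) * Z1 * (const2 (q1 L b) * Z1) * (const2 (q1 L b) * Z1 * (const2 (q1 L b) * Z1))) =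
       const2 (q1 L b ^ 4) * (Z1 * Z1 * (Z1 * Z1))"
    by (simp add: const2_hom power4_eq_xxxx mult_ac)
  finally show "qPA1_eq2 L b f g \<longleftrightarrow> lhs2 L b x y = rhs2 L b x y"
    using Z1_nz c0[of "q1 L b ^ 4"] q1_nz[OF good] by simp
qed

subsection \<open>The formal solution\<close>

definition from_series :: "complex fps fps \<Rightarrow> tps" where
  "from_series A n i = (if int n < i then 0 else coeff2 A n (nat (int n - i)))"

lemma to_from_series: "to_series (from_series A) = A"
  by (rule series2_eqI) (simp add: from_series_def)

definition solution_f :: "complex \<Rightarrow> (nat \<Rightarrow> complex) \<Rightarrow> complex fps fps" where
  "solution_f L b = Z1 * (1 + qPA1.sol1 L b)"

definition solution_g :: "complex \<Rightarrow> (nat \<Rightarrow> complex) \<Rightarrow> complex fps fps" where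
  "solution_g L b = Z1 * (const2 L * (1 + qPA1.sol2 L b))"

lemma solution_formal:
  assumes "(L, b) \<in> qPA1_good"
  shows "qPA1_formal_sol L b (from_series (solution_f L b)) (from_series (solution_g L b))"
proof -
  have "lhs1 L b (qPA1.sol1 L b) (qPA1.sol2 L b) = rhs1 L b (qPA1.sol1 L b) (qPA1.sol2 L b) \<and>
    lhs2 L b (qPA1.sol1 L b) (qPA1.sol2 L b) = rhs2 L b (qPA1.sol1 L b) (qPA1.sol2 L b)"
    using normalised_iff_fixed_point[OF assms qPA1.sol_order_ge_1] qPA1.sol_fixed by blast
  then have "qPA1_eq1 L b (from_series (solution_f L b)) (from_series (solution_g L b)) \<and>
      qPA1_eq2 L b (from_series (solution_f L b)) (from_series (solution_g L b))"
    using qPA1_eq_iff[OF assms, of "from_series (solution_f L b)" "qPA1.sol1 L b"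
        "from_series (solution_g L b)" "qPA1.sol2 L b"]
    by (simp add: to_from_series solution_f_def solution_g_def)
  then show ?thesis
    by (auto simp: qPA1_formal_sol_def from_series_def solution_f_def solution_g_def)
qed

lemma solution_leading:
  "from_series (solution_f L b) 1 1 = 1" "from_series (solution_g L b) 1 1 = L"
  using order_geD[OF qPA1.sol_order_ge_1(1), of 0 0] order_geD[OF qPA1.sol_order_ge_1(2), of 0 0]
  by (auto simp: from_series_def solution_f_def solution_g_def)

lemma solution_unique:
  assumes good: "(L, b) \<in> qPA1_good" and sol: "qPA1_formal_sol L b f g" and "f 1 1 = 1" "g 1 1 = L"
  shows "f = from_series (solution_f L b)" "g = from_series (solution_g L b)"
proof -
  \<comment> \<open>The index \<open>Suc n\<close> divides by \<open>Z1\<close>. Subtracting 1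
    leaves no constant term, thanks to the prescribed values of \<open>f 1 1\<close> and
    \<open>g 1 1\<close>.\<close>
  define x where "x = series2 (\<lambda>n m. f (Suc n) (int (Suc n) - int m)) - 1"
  define y where "y = const2 (inverse L) * series2 (\<lambda>n m. g (Suc n) (int (Suc n) - int m)) - 1"
  have L: "L \<noteq> 0" using qPA1_goodD[OF good] by blast
  have zero: "f n i = 0" "g n i = 0" if "n = 0 \<or> int n < i" for n i
    using sol that by (auto simp: qPA1_formal_sol_def)
  have f: "to_series f = Z1 * (1 + x)"
  proof (rule series2_eqI)
    show "coeff2 (to_series f) n m = coeff2 (Z1 * (1 + x)) n m" for n m
      using zero by (cases n) (auto simp: x_def)
  qed
  have g: "to_series g = Z1 * (const2 L * (1 + y))"
  proof (rule series2_eqI)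
    show "coeff2 (to_series g) n m = coeff2 (Z1 * (const2 L * (1 + y))) n m" for n m
      using zero L by (cases n) (auto simp: y_def)
  qed
  have xy: "x \<in> order_ge 1" "y \<in> order_ge 1"
    using assms(3,4) L by (auto simp: order_ge_def x_def y_def)
  have "lhs1 L b x y = rhs1 L b x y \<and> lhs2 L b x y = rhs2 L b x y"
    using sol qPA1_eq_iff[OF good f g] by (auto simp: qPA1_formal_sol_def)
  then have "x = qPA1.sol1 L b" "y = qPA1.sol2 L b"
    using normalised_iff_fixed_point[OF good xy] qPA1.sol_unique[OF xy] by blast+
  then have "to_series f = to_series (from_series (solution_f L b))"
    "to_series g = to_series (from_series (solution_g L b))"
    by (simp_all add: to_from_series f g solution_f_def solution_g_def)
  then show "f = from_series (solution_f L b)" "g = from_series (solution_g L b)"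
    using to_series_eq_iff[of f "from_series (solution_f L b)"]
      to_series_eq_iff[of g "from_series (solution_g L b)"] zero
    by (auto simp: from_series_def)
qed

lemma rational_solution:
  "rational (\<lambda>L b. from_series (solution_f L b) n i)" "rational (\<lambda>L b. from_series (solution_g L b) n i)"
  unfolding from_series_def solution_f_def solution_g_def
  by (cases "int n < i"; cases "n = 0";
      auto intro!: rational_const rational_add rational_mult rational_Lam qPA1.sol_rational)+

lemma solution_bound:
  assumes V: "compact_in_L0 b V"
  obtains r C where "0 < r" "0 \<le> C"
    "\<And>L n m. L \<in> V \<Longrightarrow> norm (from_series (solution_f L b) n (int n - int m)) \<le> C / r ^ (n + m)"
    "\<And>L n m. L \<in> V \<Longrightarrow> norm (from_series (solution_g L b) n (int n - int m)) \<le> C / r ^ (n + m)"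
proof -
  obtain r where r: "0 < r" "r \<le> 1"
    "\<And>L n m. L \<in> V \<Longrightarrow> norm (coeff2 (qPA1.sol1 L b) n m) \<le> 1 / r ^ (n + m)"
    "\<And>L n m. L \<in> V \<Longrightarrow> norm (coeff2 (qPA1.sol2 L b) n m) \<le> 1 / r ^ (n + m)"
    using qPA1.sol_bound[OF V] by blast
  have "bounded V" using V compact_imp_bounded[of V] by (simp add: compact_in_L0_def)
  then obtain B where B: "\<And>L. L \<in> V \<Longrightarrow> norm L \<le> B"
    by (meson bounded_iff)
  \<comment> \<open>The 2 pays for adding 1 to the series; \<open>max 1 B\<close> covers both the
    prefactor 1 of \<open>f\<close> and the prefactor \<open>L\<close> of \<open>g\<close>.\<close>
  define C where "C = max 1 B * 2"
  \<comment> \<open>The exponent \<open>Suc n + m\<close> anticipates the multiplication by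
    \<open>Z1\<close>; the loss is harmless because \<open>r\<close> is at most 1.\<close>
  have le: "norm (coeff2 (1 + s) n m) \<le> 2 / r ^ (Suc n + m)"
    if "\<And>n m. norm (coeff2 s n m) \<le> 1 / r ^ (n + m)" for s n m
  proof -
    have "norm (coeff2 (1 + s) n m) \<le> 1 + 1 / r ^ (n + m)"
      using norm_triangle_ineq[of "coeff2 1 n m" "coeff2 s n m"] that[of n m] by (auto split: if_splits)
    also have "\<dots> \<le> 1 / r ^ (Suc n + m) + 1 / r ^ (Suc n + m)"
    proof (rule add_mono)
      show "1 \<le> 1 / r ^ (Suc n + m)"
        using r by (auto simp: power_le_one mult_le_one)
      have "r ^ (Suc n + m) \<le> r ^ (n + m)" using r by (intro power_decreasing) auto
      then show "1 / r ^ (n + m) \<le> 1 / r ^ (Suc n + m)"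
        using r by (intro divide_left_mono) auto
    qed
    finally show ?thesis by simp
  qed
  have "norm (from_series (solution_f L b) n (int n - int m)) \<le> C / r ^ (n + m) \<and>
        norm (from_series (solution_g L b) n (int n - int m)) \<le> C / r ^ (n + m)" if "L \<in> V" for L n m
  proof (cases n)
    case 0
    then show ?thesis using r by (simp add: from_series_def solution_f_def solution_g_def C_def)
  next
    case (Suc k)
    have "norm (coeff2 (1 + qPA1.sol1 L b) k m) \<le> 2 / r ^ (n + m)"
      "norm (coeff2 (1 + qPA1.sol2 L b) k m) \<le> 2 / r ^ (n + m)"
      using le[OF r(3)[OF that]] le[OF r(4)[OF that]] Suc by auto
    moreover have "norm L \<le> max 1 B" using B[OF that] by simp
    ultimately have "1 * norm (coeff2 (1 + qPA1.sol1 L b) k m) \<le> max 1 B * (2 / r ^ (n + m))"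
      "norm L * norm (coeff2 (1 + qPA1.sol2 L b) k m) \<le> max 1 B * (2 / r ^ (n + m))"
      using r by (intro mult_mono; simp)+
    then show ?thesis
      unfolding from_series_def solution_f_def solution_g_def C_def using Suc
      by (simp add: norm_mult del: coeff2_simps(3))
  qed
  then show ?thesis using that[of r C] r by (auto simp: C_def)
qed

subsection \<open>Convergence of double series\<close>

lemma geometric_summable_on: "(\<lambda>(n, m). K * (1 / 2 :: real) ^ (n + m)) summable_on {1::nat..} \<times> (UNIV :: nat set)"
proof -
  have hs: "((\<lambda>m::nat. (1 / 2 :: real) ^ m) has_sum 2) UNIV"
    using geometric_sums[of "1/2 :: real"] by (intro norm_summable_imp_has_sum) (auto simp: summable_geometric)
  have "(\<lambda>(n, m). (1 / 2 :: real) ^ (n + m)) summable_on (UNIV :: nat set) \<times> (UNIV :: nat set)"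
  proof (rule summable_on_SigmaI)
    show "((\<lambda>m. case (n, m) of (n, m) \<Rightarrow> (1 / 2 :: real) ^ (n + m)) has_sum (1 / 2) ^ n * 2) UNIV" for n :: nat
      using has_sum_cmult_right[OF hs, of "(1 / 2) ^ n"] by (simp add: power_add)
    show "(\<lambda>n::nat. (1 / 2 :: real) ^ n * 2) summable_on UNIV"
      using hs by (intro summable_on_cmult_left) (auto simp: summable_on_def)
  qed auto
  then have "(\<lambda>(n, m). (1 / 2 :: real) ^ (n + m)) summable_on {1::nat..} \<times> (UNIV :: nat set)"
    by (rule summable_on_subset_banach) auto
  from summable_on_cmult_right[OF this, of K] show ?thesis by (simp add: case_prod_unfold)
qed

text \<open>Carries convergence along finite index sets over to the rectangular partial sums of the
  theorem.\<close>

lemma rectangles_exhaust: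
  "filterlim (\<lambda>(N, M). {1..N} \<times> {0..M}) (finite_subsets_at_top ({1::nat..} \<times> (UNIV :: nat set)))
     (sequentially \<times>\<^sub>F sequentially)"
  unfolding filterlim_finite_subsets_at_top
proof (intro allI impI)
  fix X :: "(nat \<times> nat) set" assume X: "finite X \<and> X \<subseteq> {1..} \<times> UNIV"
  define N0 where "N0 = Max (insert 0 (fst ` X \<union> snd ` X))"
  have N0: "fst p \<le> N0" "snd p \<le> N0" if "p \<in> X" for p
    unfolding N0_def using X that by (auto intro!: Max_ge)
  have "\<forall>\<^sub>F (N, M) in sequentially \<times>\<^sub>F sequentially. N0 \<le> N \<and> N0 \<le> M"
    by (intro eventually_prod_sequentially[THEN iffD2] exI[of _ N0]) auto
  then show "\<forall>\<^sub>F p in sequentially \<times>\<^sub>F sequentially. finite (case p of (N, M) \<Rightarrow> {1..N} \<times> {0..M}) \<and>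
      X \<subseteq> (case p of (N, M) \<Rightarrow> {1..N} \<times> {0..M}) \<and> (case p of (N, M) \<Rightarrow> {1..N} \<times> {0..M}) \<subseteq> {1..} \<times> UNIV"
  proof (rule eventually_mono)
    fix p :: "nat \<times> nat" assume "case p of (N, M) \<Rightarrow> N0 \<le> N \<and> N0 \<le> M"
    then obtain N M where p: "p = (N, M)" "N0 \<le> N" "N0 \<le> M" by (cases p) auto
    have "X \<subseteq> {1..N} \<times> {0..M}"
    proof
      fix z assume z: "z \<in> X"
      then have "1 \<le> fst z" using X by auto
      moreover have "fst z \<le> N" "snd z \<le> M" using N0[OF z] p by auto
      ultimately show "z \<in> {1..N} \<times> {0..M}" by (cases z) auto
    qed
    then show "finite (case p of (N, M) \<Rightarrow> {1..N} \<times> {0..M}) \<and>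
      X \<subseteq> (case p of (N, M) \<Rightarrow> {1..N} \<times> {0..M}) \<and> (case p of (N, M) \<Rightarrow> {1..N} \<times> {0..M}) \<subseteq> {1..} \<times> UNIV"
      using p by auto
  qed
qed

lemma double_series_uniform_limit:
  fixes t :: "nat \<Rightarrow> nat \<Rightarrow> 'a \<Rightarrow> complex"
  assumes "\<And>n m p. p \<in> X \<Longrightarrow> norm (t n m p) \<le> K * (1 / 2) ^ (n + m)"
  shows "uniform_limit X (\<lambda>(N, M) p. \<Sum>n\<in>{1..N}. \<Sum>m\<in>{0..M}. t n m p)
    (\<lambda>p. \<Sum>\<^sub>\<infinity>(n, m)\<in>{1..} \<times> UNIV. t n m p) (sequentially \<times>\<^sub>F sequentially)"
proof -
  have "uniform_limit X (\<lambda>S p. \<Sum>s\<in>S. (case s of (n, m) \<Rightarrow> t n m p))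
      (\<lambda>p. \<Sum>\<^sub>\<infinity>s\<in>{1..} \<times> UNIV. (case s of (n, m) \<Rightarrow> t n m p)) (finite_subsets_at_top ({1..} \<times> UNIV))"
    using assms geometric_summable_on[of K]
    by (intro Weierstrass_m_test_general[where M = "\<lambda>(n, m). K * (1 / 2) ^ (n + m)"]) auto
  from filterlim_compose[OF this rectangles_exhaust] show ?thesis
    by (simp add: case_prod_unfold sum.cartesian_product)
qed

text \<open>Termwise differentiation below works with an ordinary sequence, so the partial sums are
  restricted to \<open>N = M\<close>.\<close>

lemma double_series_uniform_limit_diagonal:
  fixes t :: "nat \<Rightarrow> nat \<Rightarrow> 'a \<Rightarrow> complex"
  assumes "\<And>n m p. p \<in> X \<Longrightarrow> norm (t n m p) \<le> K * (1 / 2) ^ (n + m)"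
  shows "uniform_limit X (\<lambda>N p. \<Sum>n\<in>{1..N}. \<Sum>m\<in>{0..N}. t n m p)
    (\<lambda>p. \<Sum>\<^sub>\<infinity>(n, m)\<in>{1..} \<times> UNIV. t n m p) sequentially"
proof -
  have "filterlim (\<lambda>N. (N, N)) (sequentially \<times>\<^sub>F sequentially) sequentially"
    by (intro filterlim_Pair filterlim_ident)
  from filterlim_compose[OF double_series_uniform_limit[OF assms] this] show ?thesis by simp
qed


text \<open>The series and its three termwise partial derivatives are all dominated by the same
  geometric double series. The distance \<open>e\<close> gives room for Cauchy's inequality in the
  parameter.\<close>

lemma double_series_holo3:
  fixes a :: "nat \<Rightarrow> nat \<Rightarrow> complex \<Rightarrow> complex"
  assumes L: "open L" and e: "0 < e" and eV: "\<And>l. l \<in> L \<Longrightarrow> cball l e \<subseteq> V"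
    and r: "0 < r" and C: "0 \<le> C"
    and hol: "\<And>n m. a n m holomorphic_on V"
    and bound: "\<And>l n m. l \<in> V \<Longrightarrow> norm (a n m l) \<le> C / r ^ (n + m)"
  defines "Z \<equiv> ball (0 :: complex) (r / 4) \<times> ball (0 :: complex) (r / 4)"
  shows "\<exists>S. uniform_limit (Z \<times> L)
      (\<lambda>(N, M) ((z1, z2), l). \<Sum>n\<in>{1..N}. \<Sum>m\<in>{0..M}. a n m l * z1 ^ n * z2 ^ m)
      S (sequentially \<times>\<^sub>F sequentially) \<and> holo3_on S (Z \<times> L)"
proof -
  define T where "T n m p = a n m (snd p) * fst (fst p) ^ n * snd (fst p) ^ m"
    for n m and p :: "(complex \<times> complex) \<times> complex"
  define D1 where "D1 n m p = a n m (snd p) * (of_nat n * fst (fst p) ^ (n - 1)) * snd (fst p) ^ m"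
    for n m and p :: "(complex \<times> complex) \<times> complex"
  define D2 where "D2 n m p = a n m (snd p) * fst (fst p) ^ n * (of_nat m * snd (fst p) ^ (m - 1))"
    for n m and p :: "(complex \<times> complex) \<times> complex"
  define D3 where "D3 n m p = deriv (a n m) (snd p) * fst (fst p) ^ n * snd (fst p) ^ m"
    for n m and p :: "(complex \<times> complex) \<times> complex"

  have pow: "norm (z ^ n) \<le> 1 * (r ^ n * (1 / 2) ^ n)" if "norm z < r / 4" for z :: complex and n
  proof -
    have "norm z ^ n \<le> (r * (1 / 2)) ^ n" using that r by (intro power_mono) auto
    then show ?thesis by (simp add: norm_power power_mult_distrib power_divide)
  qed
  \<comment> \<open>The radius \<open>r / 4\<close> rather than \<open>r / 2\<close> leaves a spare
    factor \<open>2 ^ (n - 1)\<close>, which absorbs the \<open>n\<close> produced by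
    differentiation.\<close>
  have dpow: "norm (of_nat n * z ^ (n - 1)) \<le> 2 / r * (r ^ n * (1 / 2) ^ n)"
    if "norm z < r / 4" for z :: complex and n
  proof (cases n)
    case (Suc k)
    have "real (Suc k) \<le> 2 ^ k"
      by (induction k) auto
    moreover have "norm z ^ k \<le> (r / 4) ^ k" using that by (intro power_mono) auto
    ultimately have "real (Suc k) * norm z ^ k \<le> 2 ^ k * (r / 4) ^ k"
      by (intro mult_mono) auto
    also have "\<dots> = (2 * (r / 4)) ^ k" by (rule power_mult_distrib[symmetric])
    also have "\<dots> = r ^ k * (1 / 2) ^ k" by (simp add: power_mult_distrib power_divide)
    also have "\<dots> = 2 / r * (r ^ n * (1 / 2) ^ n)" using Suc r by (simp add: field_simps)
    finally show ?thesis using Suc by (simp add: norm_mult norm_power del: of_nat_Suc)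
  qed (use r in auto)
  have prod: "norm (x * y * z) \<le> c1 * c2 * c3 * (1 / 2) ^ (n + m)"
    if "norm x \<le> c1 / r ^ (n + m)" "norm y \<le> c2 * (r ^ n * (1 / 2) ^ n)"
      "norm z \<le> c3 * (r ^ m * (1 / 2) ^ m)" for x y z :: complex and c1 c2 c3 n m
  proof -
    have "norm (x * y * z) \<le> c1 / r ^ (n + m) * (c2 * (r ^ n * (1 / 2) ^ n)) * (c3 * (r ^ m * (1 / 2) ^ m))"
      unfolding norm_mult by (intro mult_mono that mult_nonneg_nonneg norm_ge_zero
          order_trans[OF norm_ge_zero that(1)] order_trans[OF norm_ge_zero that(2)])
    also have "\<dots> = c1 * c2 * c3 * (1 / 2) ^ (n + m)"
      using r by (simp add: power_add field_simps)
    finally show ?thesis .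
  qed
  have LV: "l \<in> V" if "l \<in> L" for l using eV[OF that] e by auto
  have dbound: "norm (deriv (a n m) l) \<le> (C / e) / r ^ (n + m)" if "l \<in> L" for l n m
  proof -
    have h: "a n m holomorphic_on cball l e" using hol eV[OF that] holomorphic_on_subset by blast
    have "norm ((deriv ^^ 1) (a n m) l) \<le> fact 1 * (C / r ^ (n + m)) / e ^ 1"
    proof (rule Cauchy_inequality[OF _ _ e])
      show "a n m holomorphic_on ball l e" using h ball_subset_cball holomorphic_on_subset by blast
      show "continuous_on (cball l e) (a n m)" using h by (rule holomorphic_on_imp_continuous_on)
      show "norm (a n m x) \<le> C / r ^ (n + m)" if "norm (l - x) = e" for x
        using eV[OF \<open>l \<in> L\<close>] that by (intro bound) (auto simp: dist_norm)
    qed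
    then show ?thesis by (simp add: mult.commute)
  qed
  have Z: "norm (fst (fst p)) < r / 4" "norm (snd (fst p)) < r / 4" "snd p \<in> L" if "p \<in> Z \<times> L" for p
    using that by (auto simp: Z_def)
  have bT: "norm (T n m p) \<le> C * 1 * 1 * (1 / 2) ^ (n + m)" if "p \<in> Z \<times> L" for n m p
    unfolding T_def using Z[OF that] by (intro prod bound pow LV)
  have b1: "norm (D1 n m p) \<le> C * (2 / r) * 1 * (1 / 2) ^ (n + m)" if "p \<in> Z \<times> L" for n m p
    unfolding D1_def using Z[OF that] by (intro prod bound pow dpow LV)
  have b2: "norm (D2 n m p) \<le> C * 1 * (2 / r) * (1 / 2) ^ (n + m)" if "p \<in> Z \<times> L" for n m p
    unfolding D2_def using Z[OF that] by (intro prod bound pow dpow LV)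
  have b3: "norm (D3 n m p) \<le> (C / e) * 1 * 1 * (1 / 2) ^ (n + m)" if "p \<in> Z \<times> L" for n m p
    unfolding D3_def using Z[OF that] by (intro prod dbound pow)

  define sm where "sm t N p = (\<Sum>n\<in>{1..N}. \<Sum>m\<in>{0..N}. t n m p)"
    for t :: "nat \<Rightarrow> nat \<Rightarrow> (complex \<times> complex) \<times> complex \<Rightarrow> complex" and N p
  define lm where "lm t p = (\<Sum>\<^sub>\<infinity>(n, m)\<in>{1..} \<times> UNIV. t n m p)"
    for t :: "nat \<Rightarrow> nat \<Rightarrow> (complex \<times> complex) \<times> complex \<Rightarrow> complex" and p
  have "uniform_limit (Z \<times> L) (\<lambda>(N, M) p. \<Sum>n\<in>{1..N}. \<Sum>m\<in>{0..M}. T n m p) (lm T)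
      (sequentially \<times>\<^sub>F sequentially)"
    unfolding lm_def by (rule double_series_uniform_limit[OF bT])
  then have ul: "uniform_limit (Z \<times> L)
      (\<lambda>(N, M) ((z1, z2), l). \<Sum>n\<in>{1..N}. \<Sum>m\<in>{0..M}. a n m l * z1 ^ n * z2 ^ m)
      (lm T) (sequentially \<times>\<^sub>F sequentially)"
    by (simp add: T_def case_prod_unfold)
  have uT: "uniform_limit (Z \<times> L) (sm T) (lm T) sequentially"
    unfolding lm_def sm_def by (rule double_series_uniform_limit_diagonal[OF bT])
  have u1: "uniform_limit (Z \<times> L) (sm D1) (lm D1) sequentially"
    unfolding lm_def sm_def by (rule double_series_uniform_limit_diagonal[OF b1])
  have u2: "uniform_limit (Z \<times> L) (sm D2) (lm D2) sequentially"
    unfolding lm_def sm_def by (rule double_series_uniform_limit_diagonal[OF b2])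
  have u3: "uniform_limit (Z \<times> L) (sm D3) (lm D3) sequentially"
    unfolding lm_def sm_def by (rule double_series_uniform_limit_diagonal[OF b3])

  have dT: "(T n m has_derivative (\<lambda>h. D1 n m p * fst (fst h) + D2 n m p * snd (fst h) + D3 n m p * snd h))
      (at p within U)" if "snd p \<in> L" for n m p U
  proof -
    have "a n m holomorphic_on L" using hol LV holomorphic_on_subset by blast
    then have "(a n m has_field_derivative deriv (a n m) (snd p)) (at (snd p))"
      using L that by (intro holomorphic_derivI)
    then have A: "((\<lambda>p. a n m (snd p)) has_derivative (\<lambda>h. deriv (a n m) (snd p) * snd h)) (at p within U)"
      by (intro has_derivative_compose[of snd snd p U "a n m"] has_derivative_snd has_derivative_ident)
         (auto simp: has_field_derivative_def)
    have B: "((\<lambda>p. fst (fst p) ^ n) has_derivative (\<lambda>h. of_nat n * fst (fst h) * fst (fst p) ^ (n - 1))) (at p within U)"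
      "((\<lambda>p. snd (fst p) ^ m) has_derivative (\<lambda>h. of_nat m * snd (fst h) * snd (fst p) ^ (m - 1))) (at p within U)"
      by (intro has_derivative_power has_derivative_fst has_derivative_snd has_derivative_ident)+
    show ?thesis
      unfolding T_def D1_def D2_def D3_def
      by (rule has_derivative_eq_rhs[OF has_derivative_mult[OF has_derivative_mult[OF A B(1)] B(2)]])
         (auto simp: fun_eq_iff algebra_simps)
  qed
  have "holo3_on (lm T) (Z \<times> L)"
    unfolding holo3_on_def
  proof (intro ballI)
    fix p assume p: "p \<in> Z \<times> L"
    then obtain d where d: "0 < d" "ball (snd p) d \<subseteq> L"
      using L by (auto simp: open_contains_ball)
    \<comment> \<open>\<open>has_derivative_sequence\<close> works on convex sets; \<open>L\<close>
      need not be convex, so it is replaced by a ball around the point.\<close>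
    define U where "U = Z \<times> ball (snd p) d"
    have U: "convex U" "open U" "U \<subseteq> Z \<times> L" "p \<in> U"
      using p d by (auto simp: U_def Z_def intro!: convex_Times open_Times)
    define g' where "g' p h = lm D1 p * fst (fst h) + lm D2 p * snd (fst h) + lm D3 p * snd h"
      for p h :: "(complex \<times> complex) \<times> complex"
    define f' where "f' N p h = sm D1 N p * fst (fst h) + sm D2 N p * snd (fst h) + sm D3 N p * snd h"
      for N and p h :: "(complex \<times> complex) \<times> complex"
    have "\<exists>g. \<forall>x\<in>U. (\<lambda>N. sm T N x) \<longlonglongrightarrow> g x \<and> (g has_derivative g' x) (at x within U)"
    proof (rule has_derivative_sequence[OF U(1) _ _ U(4)])
      show "(sm T N has_derivative f' N x) (at x within U)" if "x \<in> U" for N x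
      proof -
        have "snd x \<in> L" using that U(3) by auto
        then have "(sm T N has_derivative (\<lambda>h. \<Sum>n\<in>{1..N}. \<Sum>m\<in>{0..N}.
            D1 n m x * fst (fst h) + D2 n m x * snd (fst h) + D3 n m x * snd h)) (at x within U)"
          unfolding sm_def by (intro has_derivative_sum dT)
        also have "(\<lambda>h. \<Sum>n\<in>{1..N}. \<Sum>m\<in>{0..N}.
            D1 n m x * fst (fst h) + D2 n m x * snd (fst h) + D3 n m x * snd h) = f' N x"
          by (simp add: f'_def sm_def sum.distrib sum_distrib_right fun_eq_iff)
        finally show ?thesis .
      qed
      show "\<forall>\<^sub>F N in sequentially. \<forall>x\<in>U. \<forall>h. norm (f' N x h - g' x h) \<le> \<epsilon> * norm h" if "0 < \<epsilon>" for \<epsilon>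
      proof -
        have "\<forall>\<^sub>F N in sequentially. \<forall>x\<in>Z \<times> L. dist (sm D1 N x) (lm D1 x) < \<epsilon> / 3"
          "\<forall>\<^sub>F N in sequentially. \<forall>x\<in>Z \<times> L. dist (sm D2 N x) (lm D2 x) < \<epsilon> / 3"
          "\<forall>\<^sub>F N in sequentially. \<forall>x\<in>Z \<times> L. dist (sm D3 N x) (lm D3 x) < \<epsilon> / 3"
          using uniform_limitD[OF u1, of "\<epsilon> / 3"] uniform_limitD[OF u2, of "\<epsilon> / 3"]
            uniform_limitD[OF u3, of "\<epsilon> / 3"] that by auto
        then show ?thesis
        proof eventually_elim
          case (elim N)
          show ?case
          proof (intro ballI allI)
            fix x h :: "(complex \<times> complex) \<times> complex" assume "x \<in> U"
            then have x: "x \<in> Z \<times> L" using U(3) by auto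
            have h: "norm (fst (fst h)) \<le> norm h" "norm (snd (fst h)) \<le> norm h" "norm (snd h) \<le> norm h"
              using norm_fst_le[of "fst h" "snd h"] norm_snd_le[of "snd h" "fst h"]
                norm_fst_le[of "fst (fst h)" "snd (fst h)"] norm_snd_le[of "snd (fst h)" "fst (fst h)"]
              by auto
            have "f' N x h - g' x h = (sm D1 N x - lm D1 x) * fst (fst h) +
                (sm D2 N x - lm D2 x) * snd (fst h) + (sm D3 N x - lm D3 x) * snd h"
              by (simp add: f'_def g'_def algebra_simps)
            also have "norm \<dots> \<le> \<epsilon> / 3 * norm h + \<epsilon> / 3 * norm h + \<epsilon> / 3 * norm h"
              using elim x h that
              by (intro norm_triangle_mono norm_mult_ineq[THEN order_trans] mult_mono)
                 (auto simp: dist_norm less_imp_le)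
            finally show "norm (f' N x h - g' x h) \<le> \<epsilon> * norm h" by (simp add: algebra_simps)
          qed
        qed
      qed
      show "(\<lambda>N. sm T N p) \<longlonglongrightarrow> lm T p"
        using tendsto_uniform_limitI[OF uT p] .
    qed
    then obtain g where g: "\<And>x. x \<in> U \<Longrightarrow> (\<lambda>N. sm T N x) \<longlonglongrightarrow> g x"
      "(g has_derivative g' p) (at p within U)" using U(4) by blast
    have "g x = lm T x" if "x \<in> U" for x
      using LIMSEQ_unique[OF g(1)[OF that] tendsto_uniform_limitI[OF uT]] that U(3) by blast
    then have "(lm T has_derivative g' p) (at p within U)"
      using has_derivative_transform[OF U(4) _ g(2), of "lm T"] by simp
    then have "(lm T has_derivative g' p) (at p)"
      by (simp only: at_within_open[OF U(4,2)])
    moreover have "g' p = (\<lambda>((z1, z2), z3). lm D1 p * z1 + lm D2 p * z2 + lm D3 p * z3)"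
      by (auto simp: g'_def fun_eq_iff)
    ultimately show "\<exists>a1 a2 a3. (lm T has_derivative (\<lambda>((z1, z2), z3). a1 * z1 + a2 * z2 + a3 * z3)) (at p)"
      by (intro exI[of _ "lm D1 p"] exI[of _ "lm D2 p"] exI[of _ "lm D3 p"]) simp
  qed
  with ul show ?thesis by blast
qed

section \<open>Compact neighbourhoods inside the annulus and assembly of the theorem\<close>

lemma open_L0: "open (qPA1_L0 b)"
proof -
  have "qPA1_L0 b = - {0} \<inter> {x. norm (b 1 * b 2 * b 3 * b 4) < norm x ^ 2} \<inter>
      {x. norm x ^ 2 < norm (b 5 * b 6 * b 7 * b 8)}"
    by (auto simp: qPA1_L0_def)
  also have "open \<dots>" by (intro open_Int open_Collect_less continuous_intros)
  finally show ?thesis .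
qed

lemma bounded_L0: "bounded (qPA1_L0 b)"
  unfolding bounded_iff
proof (intro exI ballI)
  fix x assume "x \<in> qPA1_L0 b"
  then have "norm x ^ 2 \<le> norm (b 5 * b 6 * b 7 * b 8)" by (simp add: qPA1_L0_def)
  then show "norm x \<le> sqrt (norm (b 5 * b 6 * b 7 * b 8))" by (rule real_le_rsqrt)
qed

lemma solution_convergence:
  assumes b: "b \<in> qPA1_B" and L: "open L" "closure L \<subseteq> qPA1_L0 b"
  shows "\<exists>Z :: (complex \<times> complex) set. open Z \<and> (0, 0) \<in> Z \<and>
    (\<exists>SF SG.
       uniform_limit (Z \<times> L)
         (\<lambda>(N, M) ((z1, z2), Lam). \<Sum>n\<in>{1..N}. \<Sum>m\<in>{0..M}.
              from_series (solution_f Lam b) n (int n - int m) * z1 ^ n * z2 ^ m)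
         SF (sequentially \<times>\<^sub>F sequentially)
     \<and> uniform_limit (Z \<times> L)
         (\<lambda>(N, M) ((z1, z2), Lam). \<Sum>n\<in>{1..N}. \<Sum>m\<in>{0..M}.
              from_series (solution_g Lam b) n (int n - int m) * z1 ^ n * z2 ^ m)
         SG (sequentially \<times>\<^sub>F sequentially)
     \<and> holo3_on SF (Z \<times> L) \<and> holo3_on SG (Z \<times> L))"
proof -
  have "compact (closure L)"
    using bounded_subset[OF bounded_L0 L(2)] by (simp add: compact_eq_bounded_closed)
  then obtain e where e: "0 < e" "(\<Union>x\<in>closure L. cball x e) \<subseteq> qPA1_L0 b"
    using compact_subset_open_imp_cball_epsilon_subset[OF _ open_L0 L(2)] by blast
  \<comment> \<open>A closed \<open>e\<close>-neighbourhood, still compact inside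
    \<open>qPA1_L0\<close>: the coefficient bounds hold on it, hence on the discs used by Cauchy's
    inequality at points of \<open>L\<close>.\<close>
  define V where "V = (\<Union>x\<in>closure L. cball x e)"
  have V: "compact_in_L0 b V"
    using b e(2) compact_minkowski_sum_cball[OF \<open>compact (closure L)\<close>] by (auto simp: compact_in_L0_def V_def)
  have eV: "cball l e \<subseteq> V" if "l \<in> L" for l
    using that closure_subset by (auto simp: V_def)
  obtain r C where rC: "0 < r" "0 \<le> C"
    "\<And>L n m. L \<in> V \<Longrightarrow> norm (from_series (solution_f L b) n (int n - int m)) \<le> C / r ^ (n + m)"
    "\<And>L n m. L \<in> V \<Longrightarrow> norm (from_series (solution_g L b) n (int n - int m)) \<le> C / r ^ (n + m)"
    using solution_bound[OF V] by blast
  define Z where "Z = ball (0 :: complex) (r / 4) \<times> ball (0 :: complex) (r / 4)"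
  have Z: "open Z" "(0, 0) \<in> Z" using rC by (auto simp: Z_def intro!: open_Times)
  have "\<exists>S. uniform_limit (Z \<times> L)
      (\<lambda>(N, M) ((z1, z2), l). \<Sum>n\<in>{1..N}. \<Sum>m\<in>{0..M}.
         from_series (solution_f l b) n (int n - int m) * z1 ^ n * z2 ^ m)
      S (sequentially \<times>\<^sub>F sequentially) \<and> holo3_on S (Z \<times> L)"
    unfolding Z_def
    by (rule double_series_holo3[OF L(1) e(1) eV rC(1,2) _ rC(3)])
       (auto intro!: rational_holomorphic rational_solution compact_in_L0_good[OF V])
  moreover have "\<exists>S. uniform_limit (Z \<times> L)
      (\<lambda>(N, M) ((z1, z2), l). \<Sum>n\<in>{1..N}. \<Sum>m\<in>{0..M}.
         from_series (solution_g l b) n (int n - int m) * z1 ^ n * z2 ^ m)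
      S (sequentially \<times>\<^sub>F sequentially) \<and> holo3_on S (Z \<times> L)"
    unfolding Z_def
    by (rule double_series_holo3[OF L(1) e(1) eV rC(1,2) _ rC(4)])
       (auto intro!: rational_holomorphic rational_solution compact_in_L0_good[OF V])
  ultimately show ?thesis using Z by blast
qed

theorem mainTheorem4:
  shows "\<exists>F G :: nat \<Rightarrow> int \<Rightarrow> complex \<Rightarrow> (nat \<Rightarrow> complex) \<Rightarrow> complex.
    (\<forall>n i. 1 \<le> n \<and> i \<le> int n \<longrightarrow>
        rat_fun_regular_on qPA1_good (F n i) \<and> rat_fun_regular_on qPA1_good (G n i))
  \<and> (\<forall>Lam b. (Lam, b) \<in> qPA1_good \<longrightarrow>
        qPA1_formal_sol Lam b (\<lambda>n i. F n i Lam b) (\<lambda>n i. G n i Lam b)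
      \<and> F 1 1 Lam b = 1 \<and> G 1 1 Lam b = Lam
      \<and> (\<forall>f g. qPA1_formal_sol Lam b f g \<and> f 1 1 = 1 \<and> g 1 1 = Lam \<longrightarrow>
              f = (\<lambda>n i. F n i Lam b) \<and> g = (\<lambda>n i. G n i Lam b)))
  \<and> (\<forall>b. b \<in> qPA1_B \<and> norm (qPA1_q b) < 1 \<longrightarrow>
        (\<forall>Lam \<in> qPA1_L0 b. (Lam, b) \<in> qPA1_good)
      \<and> (\<forall>L. open L \<and> closure L \<subseteq> qPA1_L0 b \<longrightarrow>
          (\<exists>Z :: (complex \<times> complex) set. open Z \<and> (0, 0) \<in> Z \<and>
            (\<exists>SF SG.
               uniform_limit (Z \<times> L)
                 (\<lambda>(N, M) ((z1, z2), Lam). \<Sum>n\<in>{1..N}. \<Sum>m\<in>{0..M}.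
                      F n (int n - int m) Lam b * z1 ^ n * z2 ^ m)
                 SF (sequentially \<times>\<^sub>F sequentially)
             \<and> uniform_limit (Z \<times> L)
                 (\<lambda>(N, M) ((z1, z2), Lam). \<Sum>n\<in>{1..N}. \<Sum>m\<in>{0..M}.
                      G n (int n - int m) Lam b * z1 ^ n * z2 ^ m)
                 SG (sequentially \<times>\<^sub>F sequentially)
             \<and> holo3_on SF (Z \<times> L) \<and> holo3_on SG (Z \<times> L)))))"
proof (rule exI[of _ "\<lambda>n i L b. from_series (solution_f L b) n i"],
    rule exI[of _ "\<lambda>n i L b. from_series (solution_g L b) n i"], intro conjI allI impI ballI)
  fix L :: complex and b :: "nat \<Rightarrow> complex"
  assume good: "(L, b) \<in> qPA1_good"
  show "qPA1_formal_sol L b (\<lambda>n i. from_series (solution_f L b) n i) (\<lambda>n i. from_series (solution_g L b) n i)"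
    by (rule solution_formal[OF good])
  show "from_series (solution_f L b) 1 1 = 1" "from_series (solution_g L b) 1 1 = L"
    by (rule solution_leading)+
  fix f g assume "qPA1_formal_sol L b f g \<and> f 1 1 = 1 \<and> g 1 1 = L"
  then show "f = (\<lambda>n i. from_series (solution_f L b) n i)" "g = (\<lambda>n i. from_series (solution_g L b) n i)"
    using solution_unique[OF good] by blast+
next
  fix b :: "nat \<Rightarrow> complex" and L
  assume "b \<in> qPA1_B \<and> norm (qPA1_q b) < 1" "L \<in> qPA1_L0 b"
  then show "(L, b) \<in> qPA1_good" using L0_subset_good by blast
qed (rule rational_solution, rule rational_solution, (rule solution_convergence; blast))

end
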